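(* Assume the Lindelöf hypothesis, i.e. that $\zeta(1/2 + it) \ll_\epsilon (|t|+1)^{\epsilon}$ for every $\epsilon > 0$. Let $\epsilon > 0$. For $X > 0$ let $E(X)$ be the set of real $x \in [X, 2X]$ such that the interval $[x, x + x^{\epsilon}]$ contains no integer of the form $n = n_1 n_2 n_3$ with positive integers $n_1, n_2, n_3$ satisfying $x^{1/3}/2 \le n_1, n_2, n_3 \le 2 x^{1/3}$. Then the Lebesgue measure of $E(X)$ is $o(X)$ as $X \to \infty$.
   Context: $\zeta$ denotes the Riemann zeta function. *)

theory Defs
  imports "HOL-Complex_Analysis.Complex_Analysis" "HOL-Library.Landau_Symbols"
begin

text \<open>
  The Riemann zeta function, as the analytic continuation of its Dirichlet series to the
  complex plane without 1. The continuation is unique on the connected set \<open>-{1}\<close>;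
  at the pole the value is 0 by convention.
\<close>

definition zeta :: "complex \<Rightarrow> complex" where
  "zeta s = (if s = 1 then 0 else
     (SOME f. f holomorphic_on (- {1}) \<and>
        (\<forall>z. Re z > 1 \<longrightarrow> f z = (\<Sum>n. 1 / of_nat (Suc n) powr z))) s)"

definition lindelof_hypothesis :: bool where
  "lindelof_hypothesis \<longleftrightarrow>
     (\<forall>\<epsilon>>0. \<exists>C. \<forall>t::real.
        norm (zeta (1/2 + \<i> * of_real t)) \<le> C * (\<bar>t\<bar> + 1) powr \<epsilon>)"

definition exceptional_set :: "real \<Rightarrow> real \<Rightarrow> real set" where
  "exceptional_set \<epsilon> X = {x \<in> {X..2*X}.
     \<not> (\<exists>n\<^sub>1 n\<^sub>2 n\<^sub>3 :: nat. n\<^sub>1 > 0 \<and> n\<^sub>2 > 0 \<and> n\<^sub>3 > 0 \<and>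
          real n\<^sub>1 \<in> {x powr (1/3) / 2 .. 2 * x powr (1/3)} \<and>
          real n\<^sub>2 \<in> {x powr (1/3) / 2 .. 2 * x powr (1/3)} \<and>
          real n\<^sub>3 \<in> {x powr (1/3) / 2 .. 2 * x powr (1/3)} \<and>
          real (n\<^sub>1 * n\<^sub>2 * n\<^sub>3) \<in> {x .. x + x powr \<epsilon>})}"

lemma exceptional_set_lmeasurable: "exceptional_set \<epsilon> X \<in> lmeasurable"
proof -
  have "exceptional_set \<epsilon> X \<in> sets borel"
    unfolding exceptional_set_def atLeastAtMost_iff by measurable
  then have "exceptional_set \<epsilon> X \<in> sets lebesgue"
    by simp
  moreover have "exceptional_set \<epsilon> X \<subseteq> {X..2*X}"
    by (auto simp: exceptional_set_def)
  then have "bounded (exceptional_set \<epsilon> X)"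
    using bounded_closed_interval bounded_subset by blast
  ultimately show ?thesis
    using bounded_set_imp_lmeasurable by blast
qed

end

theory Submission
  imports Defs "HOL-Probability.Probability" "HOL-Real_Asymp.Real_Asymp"
begin

text \<open>
  Localise to windows \<open>[Y, Y + Y\<^sup>1\<^sup>-\<^sup>a]\<close> and put \<open>N = Y\<^sup>1\<^sup>/\<^sup>3\<close>. Give every triple a weight that is
  Gaussian in each \<open>ln (n\<^sub>i / N)\<close> with width \<open>\<sigma> = Y\<^sup>-\<^sup>a\<close>, and compare the weighted count of
  products close to \<open>x\<close> at the fine relative scale \<open>\<delta> = Y\<^sup>2\<^sup>4\<^sup>a\<^sup>-\<^sup>1\<close>, which resolves \<open>[x, x + x\<^sup>4\<^sup>8\<^sup>a]\<close>,
  with the count at the coarse scale \<open>\<delta>\<^sub>0 = Y\<^sup>-\<^sup>6\<^sup>a\<close>. The coarse count is large for elementary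
  reasons, and the fine count is negligible at exceptional \<open>x\<close>. By Plancherel the mean square of
  their difference is an integral of \<open>|D(1/2 + it)|\<^sup>6\<close> against a kernel that is small for small \<open>|t|\<close>
  and decays beyond \<open>1 / \<delta>\<close>, where \<open>D\<close> is the weighted Dirichlet polynomial over a single \<open>n\<^sub>i\<close>.
  Since the weight is an average of \<open>n\<^sup>i\<^sup>v\<close> over Gaussian \<open>v\<close>, \<open>D(1/2 + it)\<close> is a short average of \<open>\<zeta>\<close> on the
  critical line up to a main term of size \<open>N\<^sup>1\<^sup>/\<^sup>2 / |t|\<close>, so the Lindelof hypothesis bounds it.
\<close>

section \<open>Analytic continuation of the zeta function\<close>

text \<open>The narrow width \<sigma> makes the Gaussian tail so small that the sum can be cut down
  to admissible factors; a sharp cut-off alone would not be such an average over v. Narrow weights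
  force the windows: only x within a factor 1 + \<sigma> of Y are guaranteed enough triples of large
  weight. The cost is a factor \<sigma> for each of two free variables in the coarse count and
  1/\<sigma> in the bound for each D. The exponents balance as follows. The coarse count is at least
  of order \<sigma>^2 Y^(1/2), with square Y^(1 - 4a). The mean square is split at |t| = T = Y^(3a).
  Below T, the trivial bound times the kernel gives at most Y \<open>\<delta>\<^sub>0\<close>^4 T^6
  = Y^(1 - 6a). Above T, the main term gives Y / T^4 = Y^(1 - 12a), and Lindelof with exponent 2a
  gives \<sigma>^-6 \<delta>^(-1 - 12a), at most Y^(1 - 6a). Markov's inequality leaves measure of
  order Y^(1 - 2a), a saving of Y^-a over the window length. Finally, 48a against 24a makes the gap
  about Y^(24a) standard deviations wide, so the fine count there is smaller than any power of
  Y.\<close>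

lemma halfplane_Re_greater: "open {s. Re s > c}" "connected {s. Re s > c}"
  by (auto intro: open_halfspace_Re_gt convex_connected convex_halfspace_Re_gt)

text \<open>The error of the degree \<open>K\<close> Taylor expansion of u^(1 - s) about n + 1,
  taken at u = n + 2. Indices are shifted by one so that sums over all naturals start at the base
  point 1.\<close>

definition powr_remainder :: "nat \<Rightarrow> nat \<Rightarrow> complex \<Rightarrow> complex" where
  "powr_remainder K n s = of_nat (n + 2) powr (1 - s) -
     (\<Sum>i\<le>K. ((1 - s) gchoose i) * of_nat (n + 1) powr (1 - s - of_nat i))"

lemma norm_of_nat_powr: "n > 0 \<Longrightarrow> norm (of_nat n powr (z::complex)) = real n powr Re z"
  using norm_powr_real_powr[of "of_nat n" z] by simp

text \<open>Taylor's theorem on the segment from n + 1 to n + 2. Since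
  \<open>Re s \<ge> - real K\<close>, the derivative of order K + 1 has a modulus that does not
  increase along the segment, so its value at the left end bounds it.\<close>

lemma norm_powr_remainder_le:
  assumes "Re s \<ge> - real K"
  shows "norm (powr_remainder K n s) \<le>
    norm (\<Prod>i\<le>K. 1 - s - of_nat i) * real (n + 1) powr (- Re s - real K)"
proof -
  define a where "a = 1 - s"
  define f where "f = (\<lambda>i (x::complex). (\<Prod>j<i. a - of_nat j) * x powr (a - of_nat i))"
  define S where "S = closed_segment (complex_of_real (real (n+1))) (of_real (real (n+2)))"
  have S: "\<exists>r. x = of_real r \<and> r \<ge> real (n+1)" if "x \<in> S" for x
    using that unfolding S_def closed_segment_of_real
    by (auto simp: closed_segment_eq_real_ivl)
  have "norm (f 0 (of_real (real (n+2))) - (\<Sum>i\<le>K. f i (of_real (real (n+1))) * (of_real (real (n+2)) - of_real (real (n+1))) ^ i / fact i))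
     \<le> norm (\<Prod>i\<le>K. 1 - s - of_nat i) * real (n + 1) powr (- Re s - real K) * norm (complex_of_real (real (n+2)) - of_real (real (n+1))) ^ Suc K / fact K"
  proof (rule complex_Taylor)
    show "convex S" by (simp add: S_def)
    show "complex_of_real (real (n+1)) \<in> S" "complex_of_real (real (n+2)) \<in> S" by (simp_all add: S_def)
  next
    fix i x assume x: "x \<in> S" "i \<le> K"
    then obtain r where r: "x = of_real r" "r \<ge> real (n+1)" using S by blast
    then have "x \<notin> \<real>\<^sub>\<le>\<^sub>0" by (auto simp: complex_nonpos_Reals_iff)
    then show "(f i has_field_derivative f (Suc i) x) (at x within S)"
      unfolding f_def by (auto intro!: derivative_eq_intros simp: algebra_simps)
  next
    fix x assume x: "x \<in> S"
    then obtain r where r: "x = of_real r" "r \<ge> real (n+1)" using S by blast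
    then have r0: "r > 0" by auto
    have "norm (x powr (a - of_nat (Suc K))) = r powr (- Re s - real K)"
      using r r0 by (simp add: norm_powr_real_powr a_def)
    also have "\<dots> \<le> real (n+1) powr (- Re s - real K)"
      using r r0 assms by (intro powr_mono2') auto
    finally show "norm (f (Suc K) x) \<le> norm (\<Prod>i\<le>K. 1 - s - of_nat i) * real (n + 1) powr (- Re s - real K)"
      unfolding f_def norm_mult lessThan_Suc_atMost a_def by (intro mult_left_mono) auto
  qed
  also have "norm (complex_of_real (real (n+2)) - of_real (real (n+1))) = 1"
    by simp
  also have "(\<Sum>i\<le>K. f i (of_real (real (n+1))) * (of_real (real (n+2)) - of_real (real (n+1))) ^ i / fact i)
      = (\<Sum>i\<le>K. ((1 - s) gchoose i) * of_nat (n + 1) powr (1 - s - of_nat i))"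
    by (intro sum.cong) (auto simp: f_def gbinomial_prod_rev a_def atLeast0LessThan)
  also have "f 0 (of_real (real (n+2))) = of_nat (n+2) powr (1 - s)"
    by (simp add: f_def a_def)
  finally have "norm (powr_remainder K n s) \<le> norm (\<Prod>i\<le>K. 1 - s - of_nat i) * real (n + 1) powr (- Re s - real K) / fact K"
    unfolding powr_remainder_def by simp
  also have "\<dots> \<le> norm (\<Prod>i\<le>K. 1 - s - of_nat i) * real (n + 1) powr (- Re s - real K)"
    using divide_left_mono[of 1 "fact K" "norm (\<Prod>i\<le>K. 1 - s - of_nat i) * real (n + 1) powr (- Re s - real K)"]
    by (simp add: fact_ge_1 del: of_nat_add)
  finally show ?thesis .
qed

lemma summable_Suc_powr: "c < -1 \<Longrightarrow> summable (\<lambda>n. real (n + 1) powr c)"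
  using summable_ignore_initial_segment[of "\<lambda>n. real n powr c" 1] by (simp add: summable_real_powr_iff)

lemma gbinomial_holomorphic [holomorphic_intros]:
  "f holomorphic_on A \<Longrightarrow> (\<lambda>z. f z gchoose k) holomorphic_on A"
  unfolding gbinomial_prod_rev by (intro holomorphic_intros) auto

lemma powr_remainder_holomorphic: "powr_remainder K n holomorphic_on A"
  unfolding powr_remainder_def[abs_def]
  by (intro holomorphic_intros) (auto simp: complex_nonpos_Reals_iff)

lemma suminf_powr_remainder_holomorphic:
  "(\<lambda>s. \<Sum>n. powr_remainder K n s) holomorphic_on {s. Re s > 1 - real K}"
proof (rule holomorphic_uniform_sequence)
  let ?S = "{s. Re s > 1 - real K}"
  show "open ?S" by (rule halfplane_Re_greater)
  show "(\<lambda>s. \<Sum>n<m. powr_remainder K n s) holomorphic_on ?S" for m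
    by (intro holomorphic_intros powr_remainder_holomorphic)
  fix x assume x: "x \<in> ?S"
  \<comment> \<open>Half the distance to the boundary line, so that the exponent is at most
    \<open>- 1 - d\<close> on the whole closed disc.\<close>
  define d where "d = (Re x - (1 - real K)) / 2"
  have d: "d > 0" using x by (simp add: d_def)
  have cb: "Re z \<ge> 1 - real K + d" if "z \<in> cball x d" for z
  proof -
    have "\<bar>Re (x - z)\<bar> \<le> d" using that abs_Re_le_cmod[of "x - z"] by (simp add: dist_norm)
    then have "Re x - d \<le> Re z" by simp
    moreover have "Re x - d = 1 - real K + d" by (simp add: d_def field_simps)
    ultimately show ?thesis by simp
  qed
  have "bounded ((\<lambda>s. \<Prod>i\<le>K. 1 - s - of_nat i) ` cball x d)"
    by (intro compact_imp_bounded compact_continuous_image continuous_intros) auto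
  then obtain B where B: "\<And>s. s \<in> cball x d \<Longrightarrow> norm (\<Prod>i\<le>K. 1 - s - of_nat i) \<le> B"
    unfolding bounded_iff by blast
  have "uniform_limit (cball x d) (\<lambda>m s. \<Sum>n<m. powr_remainder K n s) (\<lambda>s. \<Sum>n. powr_remainder K n s) sequentially"
  proof (rule Weierstrass_m_test)
    fix n s assume s: "s \<in> cball x d"
    have "norm (powr_remainder K n s) \<le> norm (\<Prod>i\<le>K. 1 - s - of_nat i) * real (n + 1) powr (- Re s - real K)"
      using cb[OF s] d by (intro norm_powr_remainder_le) auto
    also have "\<dots> \<le> B * real (n + 1) powr (- 1 - d)"
      using B[OF s] cb[OF s] by (intro mult_mono powr_mono) (auto intro: order_trans[OF norm_ge_zero])
    finally show "norm (powr_remainder K n s) \<le> B * real (n + 1) powr (- 1 - d)" .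
  next
    show "summable (\<lambda>n. B * real (n + 1) powr (- 1 - d))"
      using d by (intro summable_mult summable_Suc_powr) auto
  qed
  moreover have "cball x d \<subseteq> ?S" using cb d by fastforce
  ultimately show "\<exists>d>0. cball x d \<subseteq> ?S \<and>
     uniform_limit (cball x d) (\<lambda>m s. \<Sum>n<m. powr_remainder K n s) (\<lambda>s. \<Sum>n. powr_remainder K n s) sequentially"
    using d by blast
qed

section \<open>Continuing the Dirichlet series\<close>

definition dirichlet_zeta :: "complex \<Rightarrow> complex" where
  "dirichlet_zeta z = (\<Sum>n. 1 / of_nat (Suc n) powr z)"

lemma dirichlet_zeta_sums:
  assumes "Re z > 1"
  shows "(\<lambda>n. of_nat (n + 1) powr (- z)) sums dirichlet_zeta z"
proof -
  have "summable (\<lambda>n. of_nat (n + 1) powr (- z))"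
  proof (rule summable_norm_cancel)
    have "summable (\<lambda>n. real (n + 1) powr (- Re z))"
      using assms by (intro summable_Suc_powr) auto
    then show "summable (\<lambda>n. norm (of_nat (n + 1) powr (- z)))"
      by (subst norm_of_nat_powr) auto
  qed
  then show ?thesis
    unfolding dirichlet_zeta_def by (simp add: powr_minus_divide summable_sums_iff)
qed

text \<open>
  Expanding \<open>(n + 1)\<^sup>1\<^sup>-\<^sup>s\<close> around \<open>n\<close> and summing over \<open>n\<close> expresses \<open>(s - 1) \<zeta>(s)\<close> through the
  values at \<open>s + 1, s + 2, \<dots>\<close>. The binomial coefficient \<open>1 - s\<close> over \<open>i\<close> has the factor
  \<open>s + i - 2\<close>, which cancels the pole of \<open>\<zeta>(s + i - 1)\<close>.
\<close>

lemma dirichlet_zeta_recurrence: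
  assumes s: "Re s > 1" and K: "K \<ge> 1"
  shows "(s - 1) * dirichlet_zeta s = 1 + (\<Sum>n. powr_remainder K n s) -
     (\<Sum>i=2..K. ((1 - s) gchoose (i - 1)) / of_nat i * ((s + of_nat i - 2) * dirichlet_zeta (s + of_nat i - 1)))"
proof -
  have tel: "(\<lambda>n. of_nat (n + 2) powr (1 - s) - of_nat (n + 1) powr (1 - s)) sums (0 - 1)"
  proof -
    have "(\<lambda>n. of_nat (n + 1) powr (1 - s)) \<longlonglongrightarrow> 0"
    proof (rule tendsto_norm_zero_cancel)
      have "(\<lambda>n. real n powr (1 - Re s)) \<longlonglongrightarrow> 0"
        using s by (intro tendsto_neg_powr filterlim_real_sequentially) auto
      then have "(\<lambda>n. real (n + 1) powr (1 - Re s)) \<longlonglongrightarrow> 0"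
        by (rule LIMSEQ_ignore_initial_segment)
      then show "(\<lambda>n. norm (of_nat (n + 1) powr (1 - s))) \<longlonglongrightarrow> 0"
        by (subst norm_of_nat_powr) auto
    qed
    from telescope_sums[OF this] show ?thesis by (simp add: add.commute)
  qed
  have z: "(\<lambda>n. ((1 - s) gchoose i) * of_nat (n + 1) powr (1 - s - of_nat i)) sums
      (((1 - s) gchoose i) * dirichlet_zeta (s + of_nat i - 1))" if "i \<in> {1..K}" for i
  proof -
    have "Re (s + of_nat i - 1) > 1" using that s by auto
    from dirichlet_zeta_sums[OF this] show ?thesis
      by (intro sums_mult) (simp add: algebra_simps)
  qed
  have "(\<lambda>n. (of_nat (n + 2) powr (1 - s) - of_nat (n + 1) powr (1 - s)) -
           (\<Sum>i=1..K. ((1 - s) gchoose i) * of_nat (n + 1) powr (1 - s - of_nat i))) sums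
       ((0 - 1) - (\<Sum>i=1..K. ((1 - s) gchoose i) * dirichlet_zeta (s + of_nat i - 1)))"
    by (intro sums_diff tel sums_sum z)
  also have "(\<lambda>n. (of_nat (n + 2) powr (1 - s) - of_nat (n + 1) powr (1 - s)) -
           (\<Sum>i=1..K. ((1 - s) gchoose i) * of_nat (n + 1) powr (1 - s - of_nat i))) = (\<lambda>n. powr_remainder K n s)"
    by (auto simp: powr_remainder_def fun_eq_iff atMost_atLeast0 sum.atLeast_Suc_atMost)
  finally have "(\<Sum>n. powr_remainder K n s) = -1 - (\<Sum>i=1..K. ((1 - s) gchoose i) * dirichlet_zeta (s + of_nat i - 1))"
    by (simp add: sums_iff)
  also have "(\<Sum>i=1..K. ((1 - s) gchoose i) * dirichlet_zeta (s + of_nat i - 1)) = (1 - s) * dirichlet_zeta s +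
      (\<Sum>i=2..K. ((1 - s) gchoose i) * dirichlet_zeta (s + of_nat i - 1))"
    using K by (subst sum.atLeast_Suc_atMost) (auto simp: numeral_2_eq_2)
  also have "(\<Sum>i=2..K. ((1 - s) gchoose i) * dirichlet_zeta (s + of_nat i - 1)) =
     - (\<Sum>i=2..K. ((1 - s) gchoose (i - 1)) / of_nat i * ((s + of_nat i - 2) * dirichlet_zeta (s + of_nat i - 1)))"
    unfolding sum_negf[symmetric]
  proof (rule sum.cong[OF refl])
    fix i assume i: "i \<in> {2..K}"
    then obtain j where j: "i = Suc j" by (cases i) auto
    have "of_nat (Suc j) * (1 - s gchoose Suc j) = (1 - s - of_nat j) * (1 - s gchoose j)"
      using gbinomial_mult_1[of "1 - s" j] by (simp add: algebra_simps)
    then have "(1 - s gchoose Suc j) = (1 - s - of_nat j) * (1 - s gchoose j) / of_nat (Suc j)"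
      by (metis nonzero_mult_div_cancel_left of_nat_neq_0)
    then have "((1 - s) gchoose i) = - (((1 - s) gchoose (i - 1)) / of_nat i * (s + of_nat i - 2))"
      unfolding j by (simp add: field_simps del: of_nat_Suc) (simp add: algebra_simps)
    then show "((1 - s) gchoose i) * dirichlet_zeta (s + of_nat i - 1) =
      - (((1 - s) gchoose (i - 1)) / of_nat i * ((s + of_nat i - 2) * dirichlet_zeta (s + of_nat i - 1)))"
      by simp
  qed
  finally show ?thesis by (simp add: algebra_simps)
qed

text \<open>Each use of the recurrence widens the half-plane by one, because its terms evaluate the
  function at least one unit further right. Working with (w - 1) times the series keeps everything
  free of poles.\<close>

lemma zeta_extension_to_halfplane:
  assumes "m \<ge> 1"
  shows "\<exists>F. F holomorphic_on {s. Re s > 1 - real m} \<and> (\<forall>w. Re w > 1 \<longrightarrow> F w = (w - 1) * dirichlet_zeta w)"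
proof -
  \<comment> \<open>For \<open>m = 0\<close> the sum over \<open>{2..Suc m}\<close> is empty, so no
    holomorphy of \<open>F\<close> is asked for and the same step starts the induction from the bare
    series.\<close>
  have ext: "\<exists>F'. F' holomorphic_on {s. Re s > 1 - real (Suc m)} \<and> (\<forall>w. Re w > 1 \<longrightarrow> F' w = (w - 1) * dirichlet_zeta w)"
    if F: "m > 0 \<Longrightarrow> F holomorphic_on {s. Re s > 1 - real m}"
      "\<And>w. Re w > 1 \<Longrightarrow> F w = (w - 1) * dirichlet_zeta w" for m F
  proof (intro exI conjI allI impI)
    let ?F = "\<lambda>s. 1 + (\<Sum>n. powr_remainder (Suc m) n s) -
     (\<Sum>i=2..Suc m. ((1 - s) gchoose (i - 1)) / of_nat i * F (s + of_nat i - 1))"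
    have "(\<lambda>s. F (s + of_nat i - 1)) holomorphic_on {s. Re s > 1 - real (Suc m)}" if "i \<in> {2..Suc m}" for i
    proof -
      have "F \<circ> (\<lambda>s. s + of_nat i - 1) holomorphic_on {s. Re s > 1 - real (Suc m)}"
        using that by (intro holomorphic_on_compose_gen[OF _ F(1)] holomorphic_intros) auto
      then show ?thesis by (simp add: o_def)
    qed
    then show "?F holomorphic_on {s. Re s > 1 - real (Suc m)}"
      by (intro holomorphic_intros suminf_powr_remainder_holomorphic) auto
    fix w :: complex assume w: "Re w > 1"
    have "F (w + of_nat i - 1) = (w + of_nat i - 2) * dirichlet_zeta (w + of_nat i - 1)" if "i \<in> {2..Suc m}" for i
    proof -
      have "Re (w + of_nat i - 1) > 1" using that w by auto
      from F(2)[OF this] show ?thesis by (simp add: algebra_simps)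
    qed
    then show "?F w = (w - 1) * dirichlet_zeta w"
      using dirichlet_zeta_recurrence[OF w, of "Suc m"] by simp
  qed
  show ?thesis using assms
  proof (induction m rule: dec_induct)
    case base
    show ?case using ext[of 0 "\<lambda>w. (w - 1) * dirichlet_zeta w"] by simp
  next
    case (step m)
    then obtain F where "F holomorphic_on {s. Re s > 1 - real m}"
      "\<And>w. Re w > 1 \<Longrightarrow> F w = (w - 1) * dirichlet_zeta w" by blast
    then show ?case by (rule ext)
  qed
qed

text \<open>The extensions to different half-planes agree where both are defined, by the identity
  theorem, and so glue to a function on the whole plane; only then is the factor z - 1 divided
  out.\<close>

lemma zeta_continuation_exists:
  "\<exists>f. f holomorphic_on (- {1}) \<and> (\<forall>z. Re z > 1 \<longrightarrow> f z = dirichlet_zeta z)"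
proof -
  have "\<forall>m. \<exists>F. F holomorphic_on {s. Re s > - real m} \<and> (\<forall>w. Re w > 1 \<longrightarrow> F w = (w - 1) * dirichlet_zeta w)"
  proof
    fix m
    show "\<exists>F. F holomorphic_on {s. Re s > - real m} \<and> (\<forall>w. Re w > 1 \<longrightarrow> F w = (w - 1) * dirichlet_zeta w)"
      using zeta_extension_to_halfplane[of "Suc m"] by simp
  qed
  from choice[OF this] obtain G where G': "\<forall>m. G m holomorphic_on {s. Re s > - real m} \<and>
    (\<forall>w. Re w > 1 \<longrightarrow> G m w = (w - 1) * dirichlet_zeta w)" ..
  have G: "G m holomorphic_on {s. Re s > - real m}" for m
    using G' by simp
  have G1: "G m w = (w - 1) * dirichlet_zeta w" if "Re w > 1" for m w
    using G' that by simp
  have eq: "G m z = G n z" if "m \<le> n" "Re z > - real m" for m n z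
  proof (rule analytic_continuation_open[of "{s. Re s > 1}" "{s. Re s > - real m}" "G m" "G n"])
    show "{s. Re s > 1} \<noteq> {}" by (auto intro!: exI[of _ 2])
    show "G n holomorphic_on {s. - real m < Re s}"
      by (rule holomorphic_on_subset[OF G[of n]]) (use that in auto)
    show "G m w = G n w" if "w \<in> {s. Re s > 1}" for w
      using that by (simp add: G1)
    show "G m holomorphic_on {s. - real m < Re s}" by (rule G)
    show "{s. Re s > 1} \<subseteq> {s. Re s > - real m}" by auto
    show "z \<in> {s. Re s > - real m}" using that by simp
  qed (rule halfplane_Re_greater)+
  have eq': "G m z = G n z" if "Re z > - real m" "Re z > - real n" for m n z
  proof (cases "m \<le> n")
    case True
    then show ?thesis using eq that by blast
  next
    case False
    then show ?thesis using eq[of n m z] that by simp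
  qed
  \<comment> \<open>Any index with \<open>Re z > - real m\<close> gives the same value; this one is
    explicit.\<close>
  define f where "f z = G (nat \<lceil>1 - Re z\<rceil>) z / (z - 1)" for z
  have f: "f z = G m z / (z - 1)" if "Re z > - real m" for z m
  proof -
    have "Re z > - real (nat \<lceil>1 - Re z\<rceil>)" by linarith
    from eq'[OF this that] show ?thesis by (simp add: f_def)
  qed
  have "f holomorphic_on (\<Union>m. {s. Re s > - real m} - {1})"
  proof (rule holomorphic_on_UN_open)
    fix m
    have "(\<lambda>z. G m z / (z - 1)) holomorphic_on {s. Re s > - real m} - {1}"
      by (intro holomorphic_intros holomorphic_on_subset[OF G[of m]]) auto
    then show "f holomorphic_on {s. Re s > - real m} - {1}"
      by (rule holomorphic_transform) (use f[of m] in auto)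
    show "open ({s. Re s > - real m} - {1})" by (intro open_Diff halfplane_Re_greater) auto
  qed
  also have "(\<Union>m. {s. Re s > - real m} - {1}) = - {1}"
  proof (intro equalityI subsetI)
    fix z :: complex assume "z \<in> - {1}"
    moreover obtain m :: nat where "- Re z < real m" using reals_Archimedean2 by blast
    ultimately show "z \<in> (\<Union>m. {s. Re s > - real m} - {1})" by (auto intro!: exI[of _ m])
  qed auto
  finally have "f holomorphic_on - {1}" .
  moreover have "f z = dirichlet_zeta z" if "Re z > 1" for z
  proof -
    have "z \<noteq> 1" using that by auto
    then show ?thesis using that f[of 0 z] G1[of z 0] by simp
  qed
  ultimately show ?thesis by blast
qed

section \<open>Zeta on the critical line\<close>

lemma zeta_holomorphic: "zeta holomorphic_on (- {1})"
  and zeta_eq_dirichlet: "Re z > 1 \<Longrightarrow> zeta z = dirichlet_zeta z"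
proof -
  define f where "f = (SOME f. f holomorphic_on (- {1}) \<and>
        (\<forall>z. Re z > 1 \<longrightarrow> f z = (\<Sum>n. 1 / of_nat (Suc n) powr z)))"
  have f: "f holomorphic_on (- {1}) \<and> (\<forall>z. Re z > 1 \<longrightarrow> f z = dirichlet_zeta z)"
    using someI_ex[OF zeta_continuation_exists] unfolding f_def dirichlet_zeta_def .
  have z: "zeta s = f s" if "s \<noteq> 1" for s
    using that unfolding zeta_def f_def by simp
  show "zeta holomorphic_on (- {1})"
    using f by (metis (no_types, lifting) ComplD holomorphic_transform singletonI z)
  show "zeta z = dirichlet_zeta z" if "Re z > 1"
    using f z[of z] that by (cases "z = 1") auto
qed

text \<open>For \<open>K = 1\<close> the recurrence contains no shifted zeta values, and both sides
  are holomorphic for Re z > 0. The point 1 is removed because the convention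
  \<open>zeta 1 = 0\<close> breaks the identity there; the punctured half-plane is still
  connected.\<close>

lemma zeta_eq_suminf_powr_remainder:
  assumes "Re z > 0" "z \<noteq> 1"
  shows "(z - 1) * zeta z = 1 + (\<Sum>n. powr_remainder 1 n z)"
proof (rule analytic_continuation_open[of "{s. Re s > 1}" "{s. Re s > 0} - {1}" 
      "\<lambda>z. (z - 1) * zeta z" "\<lambda>z. 1 + (\<Sum>n. powr_remainder 1 n z)"])
  show "{s. Re s > 1} \<noteq> {}" by (auto intro!: exI[of _ 2])
  show "connected ({s. Re s > 0} - {1})"
    by (intro connected_open_delete halfplane_Re_greater) auto
  show "open ({s. Re s > 0} - {1})" by (intro open_Diff halfplane_Re_greater) auto
  show "(\<lambda>z. (z - 1) * zeta z) holomorphic_on {s. Re s > 0} - {1}"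
    by (intro holomorphic_intros holomorphic_on_subset[OF zeta_holomorphic]) auto
  show "(\<lambda>z. 1 + (\<Sum>n. powr_remainder 1 n z)) holomorphic_on {s. Re s > 0} - {1}"
    by (intro holomorphic_intros holomorphic_on_subset[OF suminf_powr_remainder_holomorphic[of 1]]) auto
  show "(s - 1) * zeta s = 1 + (\<Sum>n. powr_remainder 1 n s)" if "s \<in> {s. Re s > 1}" for s
    using that dirichlet_zeta_recurrence[of s 1] by (simp add: zeta_eq_dirichlet)
  show "z \<in> {s. Re s > 0} - {1}" using assms by simp
  show "{s. Re s > 1} \<subseteq> {s. Re s > 0} - {1}" by auto
qed (rule halfplane_Re_greater)

text \<open>Euler-Maclaurin summation of first order: after division by z - 1, the remainder
  \<open>T n\<close> is the term (n + 1)^(-z) minus the integral of u^(-z) from n + 1 to n + 2, and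
  the integrals telescope. The tail stays a series, to be made small by choosing \<open>M\<close>
  large in terms of t and \<sigma>.\<close>

lemma norm_zeta_partial_sum_le:
  assumes z: "Re z = 1/2"
  shows "norm ((\<Sum>n<M. of_nat (n + 1) powr (- z)) - (of_nat (M + 1) powr (1 - z) - 1) / (1 - z)) \<le>
    norm (zeta z) + 2 + norm z * (\<Sum>n. real (n + M + 1) powr (-3/2))"
proof -
  have z1: "z \<noteq> 1" using z by auto
  define T where "T n = powr_remainder 1 n z / (z - 1)" for n
  have T: "norm (T n) \<le> norm z * real (n + 1) powr (-3/2)" for n
  proof -
    have "norm (powr_remainder 1 n z) \<le> norm (z - 1) * (norm z * real (n + 1) powr (-3/2))"
      using norm_powr_remainder_le[of 1 z n] z by (simp add: norm_mult norm_minus_commute mult_ac)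
    then show ?thesis using z1 by (simp add: T_def norm_divide divide_le_eq mult_ac)
  qed
  have sm: "summable (\<lambda>n. norm z * real (n + 1) powr (-3/2))"
    by (intro summable_mult summable_Suc_powr) auto
  have sT: "summable T" by (rule summable_comparison_test'[OF sm]) (use T in auto)
  have "powr_remainder 1 n z = of_nat (n + 2) powr (1 - z) - of_nat (n + 1) powr (1 - z) - (1 - z) * of_nat (n + 1) powr (- z)" for n
    by (simp add: powr_remainder_def algebra_simps)
  then have Teq: "T n = of_nat (n + 1) powr (- z) - (of_nat (n + 2) powr (1 - z) - of_nat (n + 1) powr (1 - z)) / (1 - z)" for n
    using z1 by (simp add: T_def divide_simps) (simp add: algebra_simps)
  have "(\<Sum>n<M. of_nat (n + 2) powr (1 - z) - of_nat (n + 1) powr (1 - z)) = of_nat (M + 1) powr (1 - z) - 1"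
    using sum_lessThan_telescope[of "\<lambda>n. of_nat (n + 1) powr (1 - z)" M] by (simp add: add.commute)
  then have "(\<Sum>n<M. of_nat (n + 1) powr (- z)) - (of_nat (M + 1) powr (1 - z) - 1) / (1 - z) = (\<Sum>n<M. T n)"
    by (simp add: Teq sum_subtractf sum_divide_distrib[symmetric] del: of_nat_add)
  also have "\<dots> = suminf T - (\<Sum>n. T (n + M))"
    using suminf_minus_initial_segment[OF sT, of M] by simp
  also have "suminf T = zeta z - 1 / (z - 1)"
    using zeta_eq_suminf_powr_remainder[OF _ z1] z z1 suminf_divide[of "\<lambda>n. powr_remainder 1 n z" "z - 1"] sT
    unfolding T_def[abs_def] by (simp add: field_simps)
  also have "norm (zeta z - 1 / (z - 1) - (\<Sum>n. T (n + M))) \<le> norm (zeta z) + norm (1 / (z - 1)) + norm (\<Sum>n. T (n + M))"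
    by (meson add_mono norm_triangle_ineq4 order_refl order_trans)
  also have "norm (1 / (z - 1)) \<le> 2"
  proof -
    have "1/2 \<le> norm (z - 1)" using z abs_Re_le_cmod[of "z - 1"] by simp
    then show ?thesis using le_imp_inverse_le[of "1/2" "norm (z - 1)"] by (simp add: norm_divide inverse_eq_divide)
  qed
  also have "norm (\<Sum>n. T (n + M)) \<le> (\<Sum>n. norm z * real (n + M + 1) powr (-3/2))"
    using summable_ignore_initial_segment[OF sm, of M] T[of "_ + M"] by (intro norm_suminf_le) (auto simp: add_ac)
  also have "\<dots> = norm z * (\<Sum>n. real (n + M + 1) powr (-3/2))"
    using summable_ignore_initial_segment[OF summable_Suc_powr, of "-3/2" M] by (intro suminf_mult) (auto simp: add_ac)
  finally show ?thesis by simp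
qed

section \<open>Gaussian integrals\<close>

text \<open>After a shift by \<open>m\<close> and a reflection this is a convolution of centred
  Gaussians, whose variances add.\<close>

lemma normal_density_product_integral:
  assumes [simp]: "s > 0" "r > 0"
  shows "has_bochner_integral lborel (\<lambda>u. normal_density 0 s (u - l) * normal_density 0 r (u - m))
           (normal_density 0 (sqrt (s\<^sup>2 + r\<^sup>2)) (l - m))"
proof (rule has_bochner_integral_nn_integral)
  have "(\<integral>\<^sup>+u. ennreal (normal_density 0 s (u - l) * normal_density 0 r (u - m)) \<partial>lborel) =
        (\<integral>\<^sup>+y. ennreal (normal_density 0 s ((l - m) - y) * normal_density 0 r y) \<partial>lborel)"
    by (subst nn_integral_real_affine[where c = 1 and t = m])
       (auto simp: normal_density_def power2_commute algebra_simps intro!: nn_integral_cong)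
  also have "\<dots> = normal_density 0 (sqrt (s\<^sup>2 + r\<^sup>2)) (l - m)"
    using conv_normal_density_zero_mean[of s r] by (simp add: fun_eq_iff)
  finally show "(\<integral>\<^sup>+u. ennreal (normal_density 0 s (u - l) * normal_density 0 r (u - m)) \<partial>lborel) =
     ennreal (normal_density 0 (sqrt (s\<^sup>2 + r\<^sup>2)) (l - m))" .
qed auto

lemma integral_std_normal_distribution_iexp:
  "(LINT x|std_normal_distribution. iexp (y * x)) = of_real (exp (- y\<^sup>2 / 2))"
  using fun_cong[OF char_std_normal_distribution, of y] by (simp add: char_def)

lemma integrable_std_normal_bounded:
  fixes f :: "real \<Rightarrow> 'b::{banach, second_countable_topology}"
  assumes "f \<in> borel_measurable borel" "\<And>x. norm (f x) \<le> B"
  shows "integrable std_normal_distribution f"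
proof -
  interpret prob_space std_normal_distribution by (rule prob_space_normal_density) simp
  show ?thesis using assms by (intro integrable_const_bound[where B = B]) auto
qed

text \<open>The real part of the characteristic function of the standard normal at
  \<open>y / c\<close>, rescaled by x = c t.\<close>

lemma gaussian_cos_integral:
  assumes "c > 0"
  shows "has_bochner_integral lborel (\<lambda>t. exp (- (c * t)\<^sup>2 / 2) * cos (t * y)) (2 * pi * normal_density 0 c y)"
proof -
  have int: "integrable std_normal_distribution (\<lambda>x. iexp (y / c * x))"
    by (rule integrable_std_normal_bounded[where B = 1]) auto
  have "Re (LINT x|std_normal_distribution. iexp (y / c * x)) = (LINT x|std_normal_distribution. Re (iexp (y / c * x)))"
    by (rule integral_Re[OF int, symmetric])
  then have "(LINT x|std_normal_distribution. cos (y / c * x)) = exp (- (y / c)\<^sup>2 / 2)"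
    unfolding integral_std_normal_distribution_iexp by (simp add: Re_exp)
  moreover have "integrable std_normal_distribution (\<lambda>x. cos (y / c * x))"
    by (rule integrable_std_normal_bounded[where B = 1]) auto
  ultimately have "has_bochner_integral std_normal_distribution (\<lambda>x. cos (y / c * x)) (exp (- (y / c)\<^sup>2 / 2))"
    by (simp add: has_bochner_integral_iff)
  then have "has_bochner_integral lborel (\<lambda>x. std_normal_density x * cos (y / c * x)) (exp (- (y / c)\<^sup>2 / 2))"
    by (simp add: has_bochner_integral_iff integrable_density integral_density)
  from lborel_has_bochner_integral_real_affine_iff[THEN iffD1, OF _ this, of c 0] assms
  have "has_bochner_integral lborel (\<lambda>t. std_normal_density (c * t) * cos (y * t)) (exp (- (y / c)\<^sup>2 / 2) / c)"
    by (simp add: field_simps)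
  from has_bochner_integral_mult_right[OF this, of "sqrt (2 * pi)"]
  have "has_bochner_integral lborel (\<lambda>t. exp (- (c * t)\<^sup>2 / 2) * cos (t * y)) (sqrt (2 * pi) * (exp (- (y / c)\<^sup>2 / 2) / c))"
    by (simp add: normal_density_def mult_ac)
  moreover have "sqrt (2 * pi) * (exp (- (y / c)\<^sup>2 / 2) / c) = 2 * pi * normal_density 0 c y"
    using assms real_sqrt_mult_self[of "2 * pi"] by (simp add: normal_density_def real_sqrt_mult power_divide field_simps)
  ultimately show ?thesis by simp
qed

lemma norm_sum_cis_squared:
  "norm (\<Sum>j\<in>A. complex_of_real (c j) * cis (- t * l j)) ^ 2 = (\<Sum>j\<in>A. \<Sum>k\<in>A. c j * c k * cos (t * (l j - l k)))"
proof -
  have "norm (\<Sum>j\<in>A. complex_of_real (c j) * cis (- t * l j)) ^ 2 =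
      (\<Sum>j\<in>A. c j * cos (t * l j)) ^ 2 + (\<Sum>j\<in>A. c j * sin (t * l j)) ^ 2"
    by (simp add: cmod_power2 sum_negf)
  also have "\<dots> = (\<Sum>j\<in>A. \<Sum>k\<in>A. c j * c k * cos (t * (l j - l k)))"
    by (simp add: power2_eq_square sum_product sum.distrib[symmetric] right_diff_distrib cos_diff algebra_simps)
  finally show ?thesis .
qed

text \<open>\<open>F\<close> is a finite combination of Gaussians, so Plancherel reduces to explicit
  integrals: both squares expand over pairs j, k, and the two integrals for each pair are the same
  combination of densities at \<open>l j - l k\<close>, up to the factor 2 \<pi>.\<close>

lemma gaussian_plancherel:
  fixes A :: "'j set" and c l :: "'j \<Rightarrow> real"
  assumes s: "s > 0" and r: "r > 0"
  defines "F \<equiv> \<lambda>u. \<Sum>j\<in>A. c j * (normal_density 0 s (u - l j) - normal_density 0 r (u - l j))"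
    and "W \<equiv> \<lambda>t. (exp (- (s * t)\<^sup>2 / 2) - exp (- (r * t)\<^sup>2 / 2))\<^sup>2 * norm (\<Sum>j\<in>A. complex_of_real (c j) * cis (- t * l j)) ^ 2"
  shows "integrable lborel (\<lambda>u. (F u)\<^sup>2)" "integrable lborel W"
    "(LINT u|lborel. (F u)\<^sup>2) = (LINT t|lborel. W t) / (2 * pi)"
proof -
  define v where "v j k = normal_density 0 (sqrt (s\<^sup>2 + s\<^sup>2)) (l j - l k) - normal_density 0 (sqrt (s\<^sup>2 + r\<^sup>2)) (l j - l k)
     - normal_density 0 (sqrt (r\<^sup>2 + s\<^sup>2)) (l j - l k) + normal_density 0 (sqrt (r\<^sup>2 + r\<^sup>2)) (l j - l k)" for j k
  have pos: "sqrt (s\<^sup>2 + s\<^sup>2) > 0" "sqrt (s\<^sup>2 + r\<^sup>2) > 0" "sqrt (r\<^sup>2 + s\<^sup>2) > 0" "sqrt (r\<^sup>2 + r\<^sup>2) > 0"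
    using s r by (auto intro: add_pos_pos)
  have "has_bochner_integral lborel (\<lambda>u. \<Sum>j\<in>A. \<Sum>k\<in>A. c j * c k *
      (normal_density 0 s (u - l j) * normal_density 0 s (u - l k)
     - normal_density 0 s (u - l j) * normal_density 0 r (u - l k)
     - normal_density 0 r (u - l j) * normal_density 0 s (u - l k)
     + normal_density 0 r (u - l j) * normal_density 0 r (u - l k)))
     (\<Sum>j\<in>A. \<Sum>k\<in>A. c j * c k * v j k)"
    unfolding v_def
    by (intro has_bochner_integral_sum has_bochner_integral_mult_right has_bochner_integral_add
          has_bochner_integral_diff normal_density_product_integral s r)
  also have "(\<lambda>u. \<Sum>j\<in>A. \<Sum>k\<in>A. c j * c k *
      (normal_density 0 s (u - l j) * normal_density 0 s (u - l k)
     - normal_density 0 s (u - l j) * normal_density 0 r (u - l k)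
     - normal_density 0 r (u - l j) * normal_density 0 s (u - l k)
     + normal_density 0 r (u - l j) * normal_density 0 r (u - l k))) = (\<lambda>u. (F u)\<^sup>2)"
    unfolding F_def power2_eq_square sum_product
    by (intro ext sum.cong refl) (simp add: algebra_simps)
  finally have 1: "has_bochner_integral lborel (\<lambda>u. (F u)\<^sup>2) (\<Sum>j\<in>A. \<Sum>k\<in>A. c j * c k * v j k)" .
  have "has_bochner_integral lborel (\<lambda>t. \<Sum>j\<in>A. \<Sum>k\<in>A. c j * c k *
      (exp (- (sqrt (s\<^sup>2 + s\<^sup>2) * t)\<^sup>2 / 2) * cos (t * (l j - l k))
     - exp (- (sqrt (s\<^sup>2 + r\<^sup>2) * t)\<^sup>2 / 2) * cos (t * (l j - l k))
     - exp (- (sqrt (r\<^sup>2 + s\<^sup>2) * t)\<^sup>2 / 2) * cos (t * (l j - l k))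
     + exp (- (sqrt (r\<^sup>2 + r\<^sup>2) * t)\<^sup>2 / 2) * cos (t * (l j - l k))))
     (\<Sum>j\<in>A. \<Sum>k\<in>A. c j * c k * (2 * pi * normal_density 0 (sqrt (s\<^sup>2 + s\<^sup>2)) (l j - l k) - 2 * pi * normal_density 0 (sqrt (s\<^sup>2 + r\<^sup>2)) (l j - l k)
     - 2 * pi * normal_density 0 (sqrt (r\<^sup>2 + s\<^sup>2)) (l j - l k) + 2 * pi * normal_density 0 (sqrt (r\<^sup>2 + r\<^sup>2)) (l j - l k)))"
    by (intro has_bochner_integral_sum has_bochner_integral_mult_right has_bochner_integral_add
          has_bochner_integral_diff gaussian_cos_integral pos)
  also have "(\<Sum>j\<in>A. \<Sum>k\<in>A. c j * c k * (2 * pi * normal_density 0 (sqrt (s\<^sup>2 + s\<^sup>2)) (l j - l k) - 2 * pi * normal_density 0 (sqrt (s\<^sup>2 + r\<^sup>2)) (l j - l k)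
     - 2 * pi * normal_density 0 (sqrt (r\<^sup>2 + s\<^sup>2)) (l j - l k) + 2 * pi * normal_density 0 (sqrt (r\<^sup>2 + r\<^sup>2)) (l j - l k)))
     = 2 * pi * (\<Sum>j\<in>A. \<Sum>k\<in>A. c j * c k * v j k)"
    unfolding v_def sum_distrib_left by (intro sum.cong refl) (simp add: algebra_simps)
  also have "(\<lambda>t. \<Sum>j\<in>A. \<Sum>k\<in>A. c j * c k *
      (exp (- (sqrt (s\<^sup>2 + s\<^sup>2) * t)\<^sup>2 / 2) * cos (t * (l j - l k))
     - exp (- (sqrt (s\<^sup>2 + r\<^sup>2) * t)\<^sup>2 / 2) * cos (t * (l j - l k))
     - exp (- (sqrt (r\<^sup>2 + s\<^sup>2) * t)\<^sup>2 / 2) * cos (t * (l j - l k))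
     + exp (- (sqrt (r\<^sup>2 + r\<^sup>2) * t)\<^sup>2 / 2) * cos (t * (l j - l k)))) = W"
  proof
    fix t
    \<comment> \<open>Adding variances in u amounts to multiplying the kernels in t, so the four
      terms form the square of their difference.\<close>
    have e: "exp (- (sqrt (p\<^sup>2 + q\<^sup>2) * t)\<^sup>2 / 2) = exp (- (p * t)\<^sup>2 / 2) * exp (- (q * t)\<^sup>2 / 2)" for p q :: real
      by (simp add: exp_add[symmetric] power_mult_distrib field_simps)
    show "(\<Sum>j\<in>A. \<Sum>k\<in>A. c j * c k *
      (exp (- (sqrt (s\<^sup>2 + s\<^sup>2) * t)\<^sup>2 / 2) * cos (t * (l j - l k))
     - exp (- (sqrt (s\<^sup>2 + r\<^sup>2) * t)\<^sup>2 / 2) * cos (t * (l j - l k))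
     - exp (- (sqrt (r\<^sup>2 + s\<^sup>2) * t)\<^sup>2 / 2) * cos (t * (l j - l k))
     + exp (- (sqrt (r\<^sup>2 + r\<^sup>2) * t)\<^sup>2 / 2) * cos (t * (l j - l k)))) = W t"
      unfolding W_def norm_sum_cis_squared sum_distrib_left e
      by (intro sum.cong refl) (simp add: power2_eq_square algebra_simps)
  qed
  finally have 2: "has_bochner_integral lborel W (2 * pi * (\<Sum>j\<in>A. \<Sum>k\<in>A. c j * c k * v j k))" .
  show "integrable lborel (\<lambda>u. (F u)\<^sup>2)" "integrable lborel W"
    "(LINT u|lborel. (F u)\<^sup>2) = (LINT t|lborel. W t) / (2 * pi)"
    using 1 2 by (auto simp: has_bochner_integral_iff)
qed

section \<open>Gaussian-weighted partial sums of the zeta function\<close>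

lemma std_normal_abs_expectation:
  "integrable std_normal_distribution (\<lambda>x. \<bar>x\<bar>)" "(LINT x|std_normal_distribution. \<bar>x\<bar>) \<le> 1"
proof -
  have *: "has_bochner_integral lborel (\<lambda>x. std_normal_density x * \<bar>x\<bar>) (sqrt (2/pi))"
    using std_normal_moment_abs_odd[of 0] by simp
  then show "integrable std_normal_distribution (\<lambda>x. \<bar>x\<bar>)"
    by (simp add: has_bochner_integral_iff integrable_density)
  have "(LINT x|std_normal_distribution. \<bar>x\<bar>) = sqrt (2/pi)"
    using * by (simp add: has_bochner_integral_iff integral_density)
  also have "\<dots> \<le> 1" using pi_ge_two by simp
  finally show "(LINT x|std_normal_distribution. \<bar>x\<bar>) \<le> 1" .
qed

text \<open>Integration by parts: the oscillating factor contributes 1/|t|, and for monotone f the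
  boundary terms and the total variation add up to f a + f b + |f b - f a|, twice the larger end
  value.\<close>

lemma oscillatory_integral_monotone:
  fixes f f' :: "real \<Rightarrow> real"
  assumes ab: "a \<le> b" and t: "t \<noteq> 0"
    and der: "\<And>y. (f has_real_derivative f' y) (at y)"
    and cont: "continuous_on {a..b} f'"
    and sgn: "(\<forall>y\<in>{a..b}. 0 \<le> f' y) \<or> (\<forall>y\<in>{a..b}. f' y \<le> 0)"
    and f: "0 \<le> f a" "0 \<le> f b" "f a \<le> B" "f b \<le> B"
  shows "norm (integral {a..b} (\<lambda>y. complex_of_real (f y) * exp (- (\<i> * t) * y))) \<le> 2 * B / \<bar>t\<bar>"
proof -
  define e where "e y = exp (- (\<i> * complex_of_real t) * complex_of_real y)" for y :: real
  have ne: "norm (e y) = 1" for y by (simp add: e_def)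
  have ec: "continuous_on A e" for A unfolding e_def by (intro continuous_intros)
  have fc: "continuous_on A f" for A
    using der by (meson DERIV_continuous_on has_field_derivative_at_within)
  define H where "H y = complex_of_real (f y) * (e y / (- (\<i> * t)))" for y
  have "((\<lambda>y. exp (- (\<i> * complex_of_real t) * complex_of_real y) / (- (\<i> * t))) has_vector_derivative e y) (at y within {a..b})" for y
    unfolding e_def
    by (rule has_vector_derivative_real_field) (use t in \<open>auto intro!: derivative_eq_intros\<close>)
  then have de: "((\<lambda>y. e y / (- (\<i> * t))) has_vector_derivative e y) (at y within {a..b})" for y
    unfolding e_def .
  have df: "((\<lambda>y. complex_of_real (f y)) has_vector_derivative of_real (f' y)) (at y within {a..b})" for y
    using der[of y] by (intro has_vector_derivative_of_real) (simp add: has_real_derivative_iff_has_vector_derivative has_vector_derivative_at_within)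
  have "(H has_vector_derivative (of_real (f y) * e y + of_real (f' y) * (e y / (- (\<i> * t))))) (at y within {a..b})" for y
    unfolding H_def using has_vector_derivative_mult[OF df de] .
  then have 1: "((\<lambda>y. of_real (f y) * e y + of_real (f' y) * (e y / (- (\<i> * t)))) has_integral H b - H a) {a..b}"
    by (intro fundamental_theorem_of_calculus ab)
  have i1: "(\<lambda>y. of_real (f y) * e y) integrable_on {a..b}"
    by (intro integrable_continuous_real continuous_intros fc ec)
  have i2: "(\<lambda>y. of_real (f' y) * (e y / (- (\<i> * t)))) integrable_on {a..b}"
    using t by (intro integrable_continuous_real continuous_intros cont ec) auto
  have "integral {a..b} (\<lambda>y. of_real (f y) * e y) =
     H b - H a - integral {a..b} (\<lambda>y. of_real (f' y) * (e y / (- (\<i> * t))))"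
    unfolding eq_diff_eq integral_add[OF i1 i2, symmetric] by (simp only: integral_unique[OF 1] diff_add_cancel)
  also have "norm \<dots> \<le> norm (H b) + norm (H a) + norm (integral {a..b} (\<lambda>y. of_real (f' y) * (e y / (- (\<i> * t)))))"
    by (meson add_mono norm_triangle_ineq4 order_refl order_trans)
  also have "norm (integral {a..b} (\<lambda>y. of_real (f' y) * (e y / (- (\<i> * t))))) \<le> integral {a..b} (\<lambda>y. \<bar>f' y\<bar> / \<bar>t\<bar>)"
    using t by (intro integral_norm_bound_integral i2 integrable_continuous_real continuous_intros cont)
      (auto simp: norm_mult norm_divide ne)
  also have "integral {a..b} (\<lambda>y. \<bar>f' y\<bar> / \<bar>t\<bar>) = \<bar>f b - f a\<bar> / \<bar>t\<bar>"
  proof -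
    have fi: "(f' has_integral (f b - f a)) {a..b}"
      using der by (intro fundamental_theorem_of_calculus ab)
        (simp add: has_real_derivative_iff_has_vector_derivative has_vector_derivative_at_within)
    have "((\<lambda>y. \<bar>f' y\<bar>) has_integral \<bar>f b - f a\<bar>) {a..b}"
      using sgn
    proof
      assume s: "\<forall>y\<in>{a..b}. 0 \<le> f' y"
      have "0 \<le> f b - f a" using has_integral_nonneg[OF fi] s by simp
      moreover have "((\<lambda>y. \<bar>f' y\<bar>) has_integral f b - f a) {a..b}"
        by (rule has_integral_eq[OF _ fi]) (use s in auto)
      ultimately show ?thesis by simp
    next
      assume s: "\<forall>y\<in>{a..b}. f' y \<le> 0"
      have "0 \<le> - (f b - f a)" using has_integral_nonneg[OF has_integral_neg[OF fi]] s by simp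
      moreover have "((\<lambda>y. \<bar>f' y\<bar>) has_integral - (f b - f a)) {a..b}"
        by (rule has_integral_eq[OF _ has_integral_neg[OF fi]]) (use s in auto)
      ultimately show ?thesis by simp
    qed
    then show ?thesis using has_integral_divide[of _ _ _ "\<bar>t\<bar>"] by (blast intro: integral_unique)
  qed
  also have "norm (H b) = f b / \<bar>t\<bar>" using f by (simp add: H_def norm_mult norm_divide ne)
  also have "norm (H a) = f a / \<bar>t\<bar>" using f by (simp add: H_def norm_mult norm_divide ne)
  also have "f b / \<bar>t\<bar> + f a / \<bar>t\<bar> + \<bar>f b - f a\<bar> / \<bar>t\<bar> \<le> 2 * B / \<bar>t\<bar>"
    unfolding add_divide_distrib[symmetric] using f by (intro divide_right_mono) auto
  finally show ?thesis unfolding e_def by simp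
qed

text \<open>The amplitude increases up to its peak at \<nu> + \<sigma>^2/2 and decreases afterwards,
  so the monotone case applies on each side. Completing the square gives the peak value
  \<open>B\<close>; the condition on \<open>L\<close> puts the peak inside the range.\<close>

lemma gaussian_oscillatory_integral:
  assumes \<nu>: "\<nu> \<ge> 0" and \<sigma>: "\<sigma> > 0" and L: "L \<ge> \<nu> + \<sigma>\<^sup>2 / 2" and t: "t \<noteq> 0"
  shows "norm (integral {0..L} (\<lambda>y. exp ((1/2 - \<i> * complex_of_real t) * of_real y) * of_real (exp (- ((y - \<nu>) / \<sigma>)\<^sup>2 / 2))))
    \<le> 4 * exp (\<nu> / 2 + \<sigma>\<^sup>2 / 8) / \<bar>t\<bar>"
proof -
  define f where "f y = exp (y / 2 - ((y - \<nu>) / \<sigma>)\<^sup>2 / 2)" for y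
  define f' where "f' y = f y * (1 / 2 - (y - \<nu>) / \<sigma>\<^sup>2)" for y
  define B where "B = exp (\<nu> / 2 + \<sigma>\<^sup>2 / 8)"
  define p where "p = \<nu> + \<sigma>\<^sup>2 / 2"
  define g where "g y = complex_of_real (f y) * exp (- (\<i> * t) * y)" for y :: real
  have eq: "exp ((1/2 - \<i> * complex_of_real t) * of_real y) * of_real (exp (- ((y - \<nu>) / \<sigma>)\<^sup>2 / 2)) = g y" for y
    by (simp add: g_def f_def exp_of_real[symmetric] exp_add[symmetric] algebra_simps del: exp_of_real)
  have der: "(f has_real_derivative f' y) (at y)" for y
    unfolding f_def f'_def using \<sigma> by (auto intro!: derivative_eq_intros simp: power2_eq_square field_simps)
  have fc: "continuous_on A f" for A
    using der by (meson DERIV_continuous_on has_field_derivative_at_within)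
  have cont: "continuous_on A f'" for A unfolding f'_def using \<sigma> by (intro continuous_intros fc) auto
  have f0: "0 \<le> f y" for y by (simp add: f_def)
  have fB: "f y \<le> B" for y
  proof -
    have "(\<nu> / 2 + \<sigma>\<^sup>2 / 8) - (y / 2 - ((y - \<nu>) / \<sigma>)\<^sup>2 / 2) = ((y - \<nu>) / \<sigma> - \<sigma> / 2)\<^sup>2 / 2"
      using \<sigma> by (simp add: power2_eq_square field_simps)
    then have "y / 2 - ((y - \<nu>) / \<sigma>)\<^sup>2 / 2 \<le> \<nu> / 2 + \<sigma>\<^sup>2 / 8"
      by (metis diff_ge_0_iff_ge divide_nonneg_nonneg zero_le_numeral zero_le_power2)
    then show ?thesis by (simp add: f_def B_def)
  qed
  have p: "0 \<le> p" "p \<le> L" using \<nu> L by (auto simp: p_def)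
  have i: "g integrable_on {0..L}" unfolding g_def by (intro integrable_continuous_real continuous_intros fc)
  have sgn: "0 \<le> f' y \<longleftrightarrow> y \<le> p" "y \<ge> p \<Longrightarrow> f' y \<le> 0" for y
  proof -
    have "f y > 0" by (simp add: f_def)
    moreover have "0 \<le> 1 / 2 - (y - \<nu>) / \<sigma>\<^sup>2 \<longleftrightarrow> y \<le> p" "y \<ge> p \<Longrightarrow> 1 / 2 - (y - \<nu>) / \<sigma>\<^sup>2 \<le> 0"
      unfolding p_def using \<sigma> by (simp_all add: field_simps)
    ultimately show "0 \<le> f' y \<longleftrightarrow> y \<le> p" "y \<ge> p \<Longrightarrow> f' y \<le> 0"
      unfolding f'_def by (simp_all add: zero_le_mult_iff mult_le_0_iff)
  qed
  have "norm (integral {0..p} g) \<le> 2 * B / \<bar>t\<bar>"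
    unfolding g_def using sgn by (intro oscillatory_integral_monotone[OF p(1) t der cont]) (auto simp: f0 fB)
  moreover have "norm (integral {p..L} g) \<le> 2 * B / \<bar>t\<bar>"
    unfolding g_def using sgn by (intro oscillatory_integral_monotone[OF p(2) t der cont]) (auto simp: f0 fB)
  moreover have "integral {0..L} g = integral {0..p} g + integral {p..L} g"
    using Henstock_Kurzweil_Integration.integral_combine[OF p i] by simp
  ultimately have "norm (integral {0..L} g) \<le> 2 * B / \<bar>t\<bar> + 2 * B / \<bar>t\<bar>"
    using norm_triangle_mono by fastforce
  then show ?thesis unfolding eq B_def by simp
qed

lemma integral_exp_interval:
  assumes "w \<noteq> 0" "L \<ge> 0"
  shows "(LINT y|lborel. indicator {0..L} y *\<^sub>R exp (w * complex_of_real y)) = (exp (w * of_real L) - 1) / w"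
proof -
  have c: "continuous_on {0..L} (\<lambda>y. exp (w * complex_of_real y))" by (intro continuous_intros)
  have "((\<lambda>y. exp (w * complex_of_real y) / w) has_vector_derivative exp (w * of_real y)) (at y within {0..L})" for y
    by (rule has_vector_derivative_real_field) (use assms in \<open>auto intro!: derivative_eq_intros\<close>)
  then have "((\<lambda>y. exp (w * complex_of_real y)) has_integral (exp (w * of_real L) / w - exp (w * of_real 0) / w)) {0..L}"
    by (intro fundamental_theorem_of_calculus assms)
  moreover have "set_integrable lborel {0..L} (\<lambda>y. exp (w * complex_of_real y))"
    by (rule borel_integrable_atLeastAtMost'[OF c])
  ultimately show ?thesis
    using set_borel_integral_eq_integral(2)[of "{0..L}" "\<lambda>y. exp (w * complex_of_real y)"]
    by (simp add: integral_unique diff_divide_distrib set_lebesgue_integral_def)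
qed

text \<open>The main term (e^(wL) - 1)/w is the integral of e^(wy) over [0, L]. By Fubini the
  average over x can be taken first, and it turns the phase into the Gaussian weight in y. No
  division by zero occurs, as Re w = 1/2.\<close>

lemma gaussian_average_exp:
  assumes L: "L \<ge> 0" and \<sigma>: "\<sigma> > 0"
  shows "integrable std_normal_distribution (\<lambda>x. iexp (- (\<nu> / \<sigma>) * x) *
      ((exp ((1/2 - \<i> * of_real (t - x / \<sigma>)) * of_real L) - 1) / (1/2 - \<i> * of_real (t - x / \<sigma>))))" (is "integrable _ ?g")
    and "(LINT x|std_normal_distribution. iexp (- (\<nu> / \<sigma>) * x) *
      ((exp ((1/2 - \<i> * of_real (t - x / \<sigma>)) * of_real L) - 1) / (1/2 - \<i> * of_real (t - x / \<sigma>)))) =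
    integral {0..L} (\<lambda>y. exp ((1/2 - \<i> * complex_of_real t) * of_real y) * of_real (exp (- ((y - \<nu>) / \<sigma>)\<^sup>2 / 2)))"
proof -
  interpret G: prob_space std_normal_distribution by (rule prob_space_normal_density) simp
  interpret P: pair_sigma_finite std_normal_distribution lborel ..
  define K where "K x y = indicator {0..L} y *\<^sub>R (iexp (- (\<nu> / \<sigma>) * x) * exp ((1/2 - \<i> * of_real (t - x / \<sigma>)) * complex_of_real y))" for x y :: real
  have w0: "1/2 - \<i> * complex_of_real u \<noteq> 0" for u by (simp add: complex_eq_iff)
  have Kx: "(LINT y|lborel. K x y) = ?g x" for x
  proof -
    have "K x = (\<lambda>y. iexp (- (\<nu> / \<sigma>) * x) * (indicator {0..L} y *\<^sub>R exp ((1/2 - \<i> * of_real (t - x / \<sigma>)) * complex_of_real y)))"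
      by (simp add: K_def fun_eq_iff)
    then show ?thesis by (simp only: integral_mult_right_zero integral_exp_interval[OF w0 L])
  qed
  have Ky': "K x y = indicator {0..L} y *\<^sub>R (exp ((1/2 - \<i> * complex_of_real t) * of_real y) * iexp ((y - \<nu>) / \<sigma> * x))" for x y
    unfolding K_def by (simp add: exp_add[symmetric] algebra_simps diff_divide_distrib)
  have Ky: "(LINT x|std_normal_distribution. K x y) =
     indicator {0..L} y *\<^sub>R (exp ((1/2 - \<i> * complex_of_real t) * of_real y) * of_real (exp (- ((y - \<nu>) / \<sigma>)\<^sup>2 / 2)))" for y
    unfolding Ky' using integral_std_normal_distribution_iexp[of "(y - \<nu>) / \<sigma>"] by simp
  have nK: "norm (K x y) = indicator {0..L} y * exp (y / 2)" for x y
    unfolding Ky' by (simp add: norm_mult)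
  have [measurable]: "(\<lambda>(x, y). K x y) \<in> borel_measurable (std_normal_distribution \<Otimes>\<^sub>M lborel)"
    unfolding K_def by measurable
  have "integrable lborel (K x)" for x
    unfolding K_def set_integrable_def[symmetric]
    by (intro borel_integrable_atLeastAtMost' continuous_intros)
  then have int: "integrable (std_normal_distribution \<Otimes>\<^sub>M lborel) (\<lambda>(x, y). K x y)"
    by (intro P.Fubini_integrable) (simp_all add: nK)
  show "integrable std_normal_distribution ?g"
    using P.integrable_fst[OF int] by (simp add: Kx)
  have "(LINT x|std_normal_distribution. ?g x) = (LINT y|lborel. (LINT x|std_normal_distribution. K x y))"
    using P.Fubini_integral[OF int] by (simp add: Kx)
  also have "\<dots> = integral {0..L} (\<lambda>y. exp ((1/2 - \<i> * complex_of_real t) * of_real y) * of_real (exp (- ((y - \<nu>) / \<sigma>)\<^sup>2 / 2)))"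
    unfolding Ky set_lebesgue_integral_def[symmetric]
    by (intro set_borel_integral_eq_integral borel_integrable_atLeastAtMost' continuous_intros) (use \<sigma> in auto)
  finally show "(LINT x|std_normal_distribution. ?g x) = \<dots>" .
qed


lemma of_nat_powr_eq_exp: "n > 0 \<Longrightarrow> of_nat n powr w = exp (w * of_real (ln (real n)))"
  for w :: complex
  using Ln_of_real[of "real n"] by (simp add: powr_def)

text \<open>
  Averaging \<open>n\<^sup>i\<^sup>x\<^sup>/\<^sup>\<sigma>\<close> over a standard normal \<open>x\<close> produces the Gaussian weight in \<open>ln n\<close>,
  so the weighted sum is an average of values of the partial sums of the zeta function on the
  critical line. The average of the main terms of these partial sums is an oscillatory integral.
\<close>

lemma gaussian_weighted_sum_bound:
  fixes C p \<sigma> \<nu> t :: real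
  assumes zeta: "\<And>\<tau>. norm (zeta (1/2 + \<i> * of_real \<tau>)) \<le> C * (\<bar>\<tau>\<bar> + 1) powr p"
    and p: "0 \<le> p" "p \<le> 1" and C: "C \<ge> 0" and \<sigma>: "0 < \<sigma>" "\<sigma> \<le> 1" and \<nu>: "\<nu> \<ge> 0" and t: "t \<noteq> 0"
  shows "\<exists>M\<ge>M0. norm (\<Sum>n<M. of_nat (n + 1) powr (- (1/2 + \<i> * of_real t)) *
       complex_of_real (exp (- ((ln (real (n + 1)) - \<nu>) / \<sigma>)\<^sup>2 / 2)))
     \<le> 4 * exp (\<nu> / 2 + \<sigma>\<^sup>2 / 8) / \<bar>t\<bar> + 2 * (C + 2) / \<sigma> * (1 + \<bar>t\<bar>) powr p + 1"
proof -
  interpret G: prob_space std_normal_distribution by (rule prob_space_normal_density) simp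
  \<comment> \<open>An upper bound for the average of \<open>norm (z x)\<close>, which multiplies
    the tail of the remainder series.\<close>
  define R where "R = 1 + \<bar>t\<bar> + 1 / \<sigma>"
  have R: "R > 0" using \<sigma> by (simp add: R_def add_pos_pos)
  obtain N0 where N0: "\<And>n. n \<ge> N0 \<Longrightarrow> norm (\<Sum>i. real (i + n + 1) powr (-3/2)) < 1 / R"
    using suminf_exist_split[OF _ summable_Suc_powr[of "-3/2"], of "1 / R"] R by auto
  \<comment> \<open>Three demands: the tail is below \<open>1 / R\<close>, the caller's
    \<open>M0\<close> is reached, and the amplitude peak lies below
    \<open>ln (M + 1)\<close>.\<close>
  define M where "M = max N0 (max M0 (nat \<lceil>exp (\<nu> + \<sigma>\<^sup>2 / 2)\<rceil>))"
  define r where "r = (\<Sum>i. real (i + M + 1) powr (-3/2))"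
  have r: "r * R \<le> 1"
  proof -
    have "r < 1 / R" using N0[of M] unfolding r_def[symmetric] by (simp add: M_def)
    then show ?thesis using R by (simp add: field_simps)
  qed
  have r0: "r \<ge> 0" unfolding r_def
    using summable_ignore_initial_segment[OF summable_Suc_powr[of "-3/2"], of M] by (intro suminf_nonneg) (auto simp: add_ac)
  define L where "L = ln (real (M + 1))"
  have "exp (\<nu> + \<sigma>\<^sup>2 / 2) \<le> real (M + 1)"
    unfolding M_def by linarith
  then have L: "L \<ge> \<nu> + \<sigma>\<^sup>2 / 2"
    unfolding L_def by (simp add: ln_ge_iff)
  then have L0: "L \<ge> 0" using \<nu> by (smt (verit) zero_le_power2 divide_nonneg_pos)
  define z where "z x = 1/2 + \<i> * complex_of_real (t - x / \<sigma>)" for x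
  define u where "u x = iexp (- (\<nu> / \<sigma>) * x)" for x
  have nu: "norm (u x) = 1" for x by (simp add: u_def)
  define Q where "Q x = (of_nat (M + 1) powr (1 - z x) - 1) / (1 - z x)" for x
  define S where "S x = (\<Sum>n<M. of_nat (n + 1) powr (- z x))" for x
  define D where "D = (\<Sum>n<M. of_nat (n + 1) powr (- (1/2 + \<i> * of_real t)) *
       complex_of_real (exp (- ((ln (real (n + 1)) - \<nu>) / \<sigma>)\<^sup>2 / 2)))"
  have uQ: "(\<lambda>x. u x * Q x) = (\<lambda>x. iexp (- (\<nu> / \<sigma>) * x) *
      ((exp ((1/2 - \<i> * of_real (t - x / \<sigma>)) * of_real L) - 1) / (1/2 - \<i> * of_real (t - x / \<sigma>))))"
    unfolding u_def Q_def z_def L_def by (subst of_nat_powr_eq_exp) (simp_all add: algebra_simps)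
  have iQ: "integrable std_normal_distribution (\<lambda>x. u x * Q x)"
    unfolding uQ by (rule gaussian_average_exp(1)[OF L0 \<sigma>(1)])
  have EQ: "norm (LINT x|std_normal_distribution. u x * Q x) \<le> 4 * exp (\<nu> / 2 + \<sigma>\<^sup>2 / 8) / \<bar>t\<bar>"
    unfolding uQ gaussian_average_exp(2)[OF L0 \<sigma>(1)]
    by (rule gaussian_oscillatory_integral[OF \<nu> \<sigma>(1) L t])
  have "u x * of_nat (n + 1) powr (- z x) =
     of_nat (n + 1) powr (- (1/2 + \<i> * of_real t)) * iexp ((ln (real (n + 1)) - \<nu>) / \<sigma> * x)" for n x
    unfolding u_def z_def
    by (subst (1 2) of_nat_powr_eq_exp) (simp_all add: exp_add[symmetric] algebra_simps diff_divide_distrib)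
  then have uS: "u x * S x = (\<Sum>n<M. of_nat (n + 1) powr (- (1/2 + \<i> * of_real t)) * iexp ((ln (real (n + 1)) - \<nu>) / \<sigma> * x))" for x
    unfolding S_def sum_distrib_left by simp
  have ii: "integrable std_normal_distribution (\<lambda>x. iexp (a * x))" for a
    by (rule integrable_std_normal_bounded[where B = 1]) auto
  have iS: "integrable std_normal_distribution (\<lambda>x. u x * S x)"
    unfolding uS by (intro Bochner_Integration.integrable_sum integrable_mult_right ii)
  have ES: "(LINT x|std_normal_distribution. u x * S x) = D"
    unfolding uS D_def integral_std_normal_distribution_iexp[symmetric]
    by (subst Bochner_Integration.integral_sum, rule integrable_mult_right, rule ii, simp only: integral_mult_right_zero)
  have iSQ: "integrable std_normal_distribution (\<lambda>x. u x * S x - u x * Q x)"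
    by (intro Bochner_Integration.integrable_diff iS iQ)
  \<comment> \<open>Because \<open>p \<le> 1\<close>, the growth in x is at most linear, so the
    first absolute moment of the normal distribution is all that the average needs.\<close>
  have bd: "norm (u x * S x - u x * Q x) \<le> (C + 2) * (1 + \<bar>t\<bar>) powr p * (1 + \<bar>x\<bar> / \<sigma>) + (1 + \<bar>t\<bar> + \<bar>x\<bar> / \<sigma>) * r" for x
  proof -
    have tx: "\<bar>t - x / \<sigma>\<bar> \<le> \<bar>t\<bar> + \<bar>x\<bar> / \<sigma>"
      using \<sigma> abs_triangle_ineq4[of t "x / \<sigma>"] by simp
    have xs: "\<bar>x\<bar> / \<sigma> \<ge> 0" using \<sigma> by simp
    have "\<bar>t\<bar> + \<bar>x\<bar> / \<sigma> + 1 \<le> (1 + \<bar>t\<bar>) * (1 + \<bar>x\<bar> / \<sigma>)"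
      using mult_nonneg_nonneg[OF abs_ge_zero[of t] xs] unfolding distrib_right distrib_left by linarith
    with tx have "\<bar>t - x / \<sigma>\<bar> + 1 \<le> (1 + \<bar>t\<bar>) * (1 + \<bar>x\<bar> / \<sigma>)" by linarith
    then have "(\<bar>t - x / \<sigma>\<bar> + 1) powr p \<le> ((1 + \<bar>t\<bar>) * (1 + \<bar>x\<bar> / \<sigma>)) powr p"
      using p by (intro powr_mono2) auto
    also have "\<dots> = (1 + \<bar>t\<bar>) powr p * (1 + \<bar>x\<bar> / \<sigma>) powr p"
      by (rule powr_mult)
    also have "\<dots> \<le> (1 + \<bar>t\<bar>) powr p * (1 + \<bar>x\<bar> / \<sigma>)"
      using powr_mono[of p 1 "1 + \<bar>x\<bar> / \<sigma>"] p xs by (intro mult_left_mono) auto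
    finally have 1: "(\<bar>t - x / \<sigma>\<bar> + 1) powr p \<le> (1 + \<bar>t\<bar>) powr p * (1 + \<bar>x\<bar> / \<sigma>)" .
    have 2: "1 \<le> (\<bar>t - x / \<sigma>\<bar> + 1) powr p"
      using p by (intro ge_one_powr_ge_zero) auto
    have "norm (u x * S x - u x * Q x) = norm (S x - Q x)"
      unfolding right_diff_distrib[symmetric] norm_mult nu by simp
    also have "\<dots> \<le> norm (zeta (z x)) + 2 + norm (z x) * r"
      unfolding S_def Q_def r_def by (rule norm_zeta_partial_sum_le) (simp add: z_def)
    also have "norm (zeta (z x)) + 2 \<le> C * (\<bar>t - x / \<sigma>\<bar> + 1) powr p + 2 * (\<bar>t - x / \<sigma>\<bar> + 1) powr p"
      using zeta[of "t - x / \<sigma>"] 2 unfolding z_def by linarith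
    also have "\<dots> = (C + 2) * (\<bar>t - x / \<sigma>\<bar> + 1) powr p" by (simp add: algebra_simps)
    also have "\<dots> \<le> (C + 2) * ((1 + \<bar>t\<bar>) powr p * (1 + \<bar>x\<bar> / \<sigma>))"
      using 1 C by (intro mult_left_mono) auto
    also have "norm (z x) \<le> 1 + \<bar>t\<bar> + \<bar>x\<bar> / \<sigma>"
    proof -
      have "norm (z x) \<le> norm (1/2 :: complex) + norm (\<i> * complex_of_real (t - x / \<sigma>))"
        unfolding z_def by (rule norm_triangle_ineq)
      also have "\<dots> = 1/2 + \<bar>t - x / \<sigma>\<bar>" by (simp add: norm_mult del: of_real_diff of_real_divide)
      finally show ?thesis using tx by simp
    qed
    finally show ?thesis using r0 by (simp add: mult_ac mult_right_mono)
  qed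
  have "norm (LINT x|std_normal_distribution. u x * S x - u x * Q x)
     \<le> (LINT x|std_normal_distribution. (C + 2) * (1 + \<bar>t\<bar>) powr p * (1 + \<bar>x\<bar> / \<sigma>) + (1 + \<bar>t\<bar> + \<bar>x\<bar> / \<sigma>) * r)"
    by (rule Bochner_Integration.integral_norm_bound_integral[OF iSQ])
      (use std_normal_abs_expectation(1) bd in \<open>auto intro!: Bochner_Integration.integrable_add integrable_mult_right integrable_mult_left integrable_divide\<close>)
  also have "\<dots> = (C + 2) * (1 + \<bar>t\<bar>) powr p * (1 + (LINT x|std_normal_distribution. \<bar>x\<bar>) / \<sigma>)
      + (1 + \<bar>t\<bar> + (LINT x|std_normal_distribution. \<bar>x\<bar>) / \<sigma>) * r"
    using std_normal_abs_expectation(1) G.prob_space by simp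
  also have "\<dots> \<le> (C + 2) * (1 + \<bar>t\<bar>) powr p * (2 / \<sigma>) + 1"
  proof (rule add_mono)
    have e: "(LINT x|std_normal_distribution. \<bar>x\<bar>) / \<sigma> \<le> 1 / \<sigma>"
      using std_normal_abs_expectation(2) \<sigma> by (intro divide_right_mono) auto
    have "1 \<le> 1 / \<sigma>" using \<sigma> by simp
    then show "(C + 2) * (1 + \<bar>t\<bar>) powr p * (1 + (LINT x|std_normal_distribution. \<bar>x\<bar>) / \<sigma>) \<le> (C + 2) * (1 + \<bar>t\<bar>) powr p * (2 / \<sigma>)"
      using e C by (intro mult_left_mono) auto
    have "(1 + \<bar>t\<bar> + (LINT x|std_normal_distribution. \<bar>x\<bar>) / \<sigma>) * r \<le> R * r"
      unfolding R_def using e r0 by (intro mult_right_mono) auto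
    then show "(1 + \<bar>t\<bar> + (LINT x|std_normal_distribution. \<bar>x\<bar>) / \<sigma>) * r \<le> 1" using r by (simp add: mult_ac)
  qed
  also have "(C + 2) * (1 + \<bar>t\<bar>) powr p * (2 / \<sigma>) + 1 = 2 * (C + 2) / \<sigma> * (1 + \<bar>t\<bar>) powr p + 1"
    by (simp add: field_simps)
  finally have 3: "norm (LINT x|std_normal_distribution. u x * S x - u x * Q x) \<le> 2 * (C + 2) / \<sigma> * (1 + \<bar>t\<bar>) powr p + 1" .
  have "D = (LINT x|std_normal_distribution. u x * Q x) + (LINT x|std_normal_distribution. u x * S x - u x * Q x)"
    using Bochner_Integration.integral_diff[OF iS iQ] ES by simp
  then have "norm D \<le> 4 * exp (\<nu> / 2 + \<sigma>\<^sup>2 / 8) / \<bar>t\<bar> + (2 * (C + 2) / \<sigma> * (1 + \<bar>t\<bar>) powr p + 1)"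
    using norm_triangle_mono[OF EQ 3] by simp
  moreover have "M \<ge> M0" by (simp add: M_def)
  ultimately show ?thesis unfolding D_def by (auto simp: add_ac)
qed

section \<open>Dirichlet polynomials over the central range\<close>

text \<open>With N = exp \<nu> and N^3 \<le> x \<le> 2 N^3, the cube root of x lies between N and
  3N/2. Hence the range from 3N/4 to 2N is admissible for all these x at once.\<close>

definition central_range :: "real \<Rightarrow> nat set" where
  "central_range \<nu> = {n. 3/4 * exp \<nu> \<le> real n \<and> real n \<le> 2 * exp \<nu>}"

definition gauss_coeff :: "real \<Rightarrow> real \<Rightarrow> nat \<Rightarrow> real" where
  "gauss_coeff \<sigma> \<nu> n = real n powr (-1/2) * exp (- ((ln (real n) - \<nu>) / \<sigma>)\<^sup>2 / 2)"

text \<open>The Dirichlet polynomial D(1/2 + it) of the overview, cut to the central range; the real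
  part 1/2 is carried by the factor n^(-1/2) of the coefficients.\<close>

definition central_sum :: "real \<Rightarrow> real \<Rightarrow> real \<Rightarrow> complex" where
  "central_sum \<sigma> \<nu> t = (\<Sum>n\<in>central_range \<nu>. of_real (gauss_coeff \<sigma> \<nu> n) * cis (- t * ln (real n)))"

lemma central_range_pos: "n \<in> central_range \<nu> \<Longrightarrow> n > 0"
  by (rule ccontr) (auto simp: central_range_def mult_le_0_iff)

lemma central_range_subset: "central_range \<nu> \<subseteq> {1..nat \<lfloor>2 * exp \<nu>\<rfloor>}"
  using central_range_pos by (force simp: central_range_def le_nat_floor Suc_le_eq)

lemma finite_central_range [simp]: "finite (central_range \<nu>)"
  by (rule finite_subset[OF central_range_subset]) simp

lemma card_central_range: "real (card (central_range \<nu>)) \<le> 2 * exp \<nu>"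
proof -
  have "card (central_range \<nu>) \<le> nat \<lfloor>2 * exp \<nu>\<rfloor>"
    using card_mono[OF _ central_range_subset[of \<nu>]] by simp
  then show ?thesis using of_nat_floor[of "2 * exp \<nu>"] by (smt (verit) exp_gt_zero of_nat_mono)
qed

lemma gauss_coeff_nonneg: "gauss_coeff \<sigma> \<nu> n \<ge> 0"
  by (simp add: gauss_coeff_def)

lemma norm_central_sum_trivial: "norm (central_sum \<sigma> \<nu> t) \<le> 4 * exp (\<nu> / 2)"
proof -
  have "norm (central_sum \<sigma> \<nu> t) \<le> (\<Sum>n\<in>central_range \<nu>. 2 * exp (- \<nu> / 2))"
    unfolding central_sum_def
  proof (rule sum_norm_le)
    fix n assume n: "n \<in> central_range \<nu>"
    have "gauss_coeff \<sigma> \<nu> n \<le> real n powr (-1/2) * 1"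
      unfolding gauss_coeff_def by (intro mult_left_mono) auto
    \<comment> \<open>The lower end 3N/4 is relaxed to N/4, whose square root is clean.\<close>
    also have "\<dots> \<le> (exp \<nu> / 4) powr (-1/2) * 1"
      using n by (intro mult_right_mono powr_mono2') (auto simp: central_range_def intro: order_trans[rotated])
    also have "(exp \<nu> / 4) powr (-1/2) = 2 * exp (- \<nu> / 2)"
      by (simp add: powr_divide exp_powr_real powr_minus powr_half_sqrt field_simps exp_minus)
    finally show "norm (complex_of_real (gauss_coeff \<sigma> \<nu> n) * cis (- t * ln (real n))) \<le> 2 * exp (- \<nu> / 2)"
      by (simp add: norm_mult gauss_coeff_nonneg)
  qed
  also have "\<dots> \<le> (2 * exp \<nu>) * (2 * exp (- \<nu> / 2))"
    using card_central_range[of \<nu>] by (simp add: mult_right_mono)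
  also have "\<dots> = 4 * exp (\<nu> / 2)" by (simp add: exp_add[symmetric])
  finally show ?thesis .
qed

lemma sum_inverse_squares_le: "(\<Sum>n=1..M. 1 / (real n)\<^sup>2) \<le> 2"
proof -
  have "(\<Sum>n=1..M. 1 / (real n)\<^sup>2) \<le> 2 - 1 / real M" if "M \<ge> 1" for M
    using that
  proof (induction M rule: dec_induct)
    case (step n)
    have "1 / (real (Suc n))\<^sup>2 \<le> 1 / real n - 1 / real (Suc n)"
    proof -
      have n: "real n > 0" using step by simp
      then have "1 / real n - 1 / real (Suc n) = 1 / (real n * real (Suc n))" by (simp add: field_simps)
      moreover have "1 / (real (Suc n))\<^sup>2 \<le> 1 / (real n * real (Suc n))"
        unfolding power2_eq_square using n by (intro divide_left_mono mult_right_mono) auto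
      ultimately show ?thesis by simp
    qed
    then show ?case using step by simp
  qed simp
  then show ?thesis by (cases "M \<ge> 1") (meson diff_le_eq le_add_same_cancel1 of_nat_0_le_iff order_trans zero_le_divide_1_iff, simp)
qed

lemma central_range_log_distance:
  assumes "n > 0" "n \<notin> central_range \<nu>"
  shows "\<bar>ln (real n) - \<nu>\<bar> \<ge> 1/4"
proof (cases "real n < 3/4 * exp \<nu>")
  case True
  then have "ln (real n) \<le> ln (3/4 * exp \<nu>)" using assms by (subst ln_le_cancel_iff) auto
  also have "\<dots> = ln (3/4) + \<nu>" using ln_mult_pos[of "3/4" "exp \<nu>"] by simp
  also have "ln (3/4 :: real) \<le> 3/4 - 1" by (rule ln_le_minus_one) simp
  finally show ?thesis by simp
next
  case False
  then have "2 * exp \<nu> < real n" using assms by (auto simp: central_range_def)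
  then have "ln (2 * exp \<nu>) \<le> ln (real n)" using assms by (subst ln_le_cancel_iff) auto
  moreover have "ln (2 * exp \<nu>) = ln 2 + \<nu>" by (simp add: ln_mult)
  moreover have "ln (1/2 :: real) \<le> 1/2 - 1" by (rule ln_le_minus_one) simp
  ultimately show ?thesis by (simp add: ln_div)
qed

text \<open>Outside the central range the logarithmic distance y is at least 1/4, so y^2 / (2
  \<sigma>^2) \<ge> y / (8 \<sigma>^2) \<ge> y (2 + 8 \<nu>) \<ge> 2 y + 2 \<nu> \<ge> 2 ln n.
  Discarding all such terms therefore costs at most a constant.\<close>

lemma gauss_coeff_outside_le:
  assumes n: "n > 0" "n \<notin> central_range \<nu>" and \<nu>: "\<nu> \<ge> 0" and \<sigma>: "\<sigma> > 0" "2 + 8 * \<nu> \<le> 1 / (8 * \<sigma>\<^sup>2)"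
  shows "gauss_coeff \<sigma> \<nu> n \<le> 1 / (real n)\<^sup>2"
proof -
  define y where "y = \<bar>ln (real n) - \<nu>\<bar>"
  have y: "y \<ge> 1/4" using central_range_log_distance[OF n] by (simp add: y_def)
  have "2 * ln (real n) \<le> 2 * y + 2 * \<nu>" using abs_ge_self[of "ln (real n) - \<nu>"] unfolding y_def by argo
  also have "\<dots> \<le> y * (2 + 8 * \<nu>)"
    using mult_right_mono[of "1/4" y "8 * \<nu>"] y \<nu> by (simp add: algebra_simps)
  also have "\<dots> \<le> y * (1 / (8 * \<sigma>\<^sup>2))" using \<sigma> y by (intro mult_left_mono) auto
  also have "\<dots> = (y * (1/4)) * (1 / (2 * \<sigma>\<^sup>2))" by simp
  also have "\<dots> \<le> (y * y) * (1 / (2 * \<sigma>\<^sup>2))" using y by (intro mult_right_mono mult_left_mono) auto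
  also have "\<dots> = ((ln (real n) - \<nu>) / \<sigma>)\<^sup>2 / 2"
    by (simp add: y_def power2_eq_square)
  finally have "exp (- ((ln (real n) - \<nu>) / \<sigma>)\<^sup>2 / 2) \<le> exp (- (2 * ln (real n)))"
    by simp
  also have "\<dots> = 1 / (real n)\<^sup>2"
    using n by (simp add: exp_minus exp_double field_simps)
  finally have "exp (- ((ln (real n) - \<nu>) / \<sigma>)\<^sup>2 / 2) \<le> 1 / (real n)\<^sup>2" .
  moreover have "real n powr (-1/2) \<le> 1" using n powr_mono[of "-1/2" 0 "real n"] by simp
  ultimately show ?thesis unfolding gauss_coeff_def
    using mult_mono[of "real n powr (-1/2)" 1 "exp (- ((ln (real n) - \<nu>) / \<sigma>)\<^sup>2 / 2)" "1 / (real n)\<^sup>2"] by simp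
qed

lemma norm_central_sum_le:
  assumes zeta: "\<And>\<tau>. norm (zeta (1/2 + \<i> * of_real \<tau>)) \<le> C * (\<bar>\<tau>\<bar> + 1) powr p"
    and p: "0 \<le> p" "p \<le> 1" and C: "C \<ge> 0" and \<sigma>: "0 < \<sigma>" "\<sigma> \<le> 1" and \<nu>: "\<nu> \<ge> 0" and t: "t \<noteq> 0"
    and \<sigma>\<nu>: "2 + 8 * \<nu> \<le> 1 / (8 * \<sigma>\<^sup>2)"
  shows "norm (central_sum \<sigma> \<nu> t) \<le> 8 * exp (\<nu> / 2) / \<bar>t\<bar> + (2 * C + 7) / \<sigma> * (1 + \<bar>t\<bar>) powr p"
proof -
  define g where "g n = of_real (gauss_coeff \<sigma> \<nu> n) * cis (- t * ln (real n))" for n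
  have g: "of_nat n powr (- (1/2 + \<i> * of_real t)) * complex_of_real (exp (- ((ln (real n) - \<nu>) / \<sigma>)\<^sup>2 / 2)) = g n"
    if "n > 0" for n
  proof -
    have "of_nat n powr (- (1/2 + \<i> * of_real t)) = exp (of_real (- ln (real n) / 2)) * cis (- t * ln (real n))"
    proof -
      have "- (1/2 + \<i> * complex_of_real t) * of_real (ln (real n)) = of_real (- ln (real n) / 2) + \<i> * of_real (- t * ln (real n))"
        by (simp add: algebra_simps)
      then show ?thesis by (simp only: of_nat_powr_eq_exp[OF that] cis_conv_exp exp_add)
    qed
    also have "exp (of_real (- ln (real n) / 2)) = complex_of_real (real n powr (-1/2))"
      using that by (simp only: exp_of_real) (simp add: powr_def)
    finally show ?thesis by (simp add: g_def gauss_coeff_def mult_ac)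
  qed
  \<comment> \<open>The lower bound on \<open>M\<close> ensures that the long sum contains the whole
    central range.\<close>
  from gaussian_weighted_sum_bound[OF zeta p C \<sigma> \<nu> t, of "nat \<lfloor>2 * exp \<nu>\<rfloor>"]
  obtain M where M: "M \<ge> nat \<lfloor>2 * exp \<nu>\<rfloor>" and b: "norm (\<Sum>n<M. of_nat (n + 1) powr (- (1/2 + \<i> * of_real t)) *
       complex_of_real (exp (- ((ln (real (n + 1)) - \<nu>) / \<sigma>)\<^sup>2 / 2)))
     \<le> 4 * exp (\<nu> / 2 + \<sigma>\<^sup>2 / 8) / \<bar>t\<bar> + 2 * (C + 2) / \<sigma> * (1 + \<bar>t\<bar>) powr p + 1" by blast
  have "(\<Sum>n<M. of_nat (n + 1) powr (- (1/2 + \<i> * of_real t)) *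
       complex_of_real (exp (- ((ln (real (n + 1)) - \<nu>) / \<sigma>)\<^sup>2 / 2))) = (\<Sum>n<M. g (n + 1))"
    by (intro sum.cong refl g) simp
  also have "\<dots> = (\<Sum>n=1..M. g n)"
    by (simp add: sum.atLeast1_atMost_eq)
  also have "\<dots> = (\<Sum>n\<in>{1..M} - central_range \<nu>. g n) + central_sum \<sigma> \<nu> t"
    unfolding central_sum_def g_def[symmetric]
    by (rule sum.subset_diff) (use central_range_subset[of \<nu>] M in auto)
  finally have "central_sum \<sigma> \<nu> t = (\<Sum>n<M. of_nat (n + 1) powr (- (1/2 + \<i> * of_real t)) *
       complex_of_real (exp (- ((ln (real (n + 1)) - \<nu>) / \<sigma>)\<^sup>2 / 2))) - (\<Sum>n\<in>{1..M} - central_range \<nu>. g n)"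
    by simp
  then have "norm (central_sum \<sigma> \<nu> t) \<le> (4 * exp (\<nu> / 2 + \<sigma>\<^sup>2 / 8) / \<bar>t\<bar> + 2 * (C + 2) / \<sigma> * (1 + \<bar>t\<bar>) powr p + 1)
      + norm (\<Sum>n\<in>{1..M} - central_range \<nu>. g n)"
    using norm_triangle_ineq4 b by (smt (verit))
  also have "norm (\<Sum>n\<in>{1..M} - central_range \<nu>. g n) \<le> (\<Sum>n\<in>{1..M} - central_range \<nu>. 1 / (real n)\<^sup>2)"
    by (rule sum_norm_le) (use gauss_coeff_outside_le[OF _ _ \<nu> \<sigma>(1) \<sigma>\<nu>] in \<open>auto simp: g_def norm_mult gauss_coeff_nonneg\<close>)
  also have "\<dots> \<le> (\<Sum>n=1..M. 1 / (real n)\<^sup>2)" by (rule sum_mono2) auto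
  also have "\<dots> \<le> 2" by (rule sum_inverse_squares_le)
  also have "4 * exp (\<nu> / 2 + \<sigma>\<^sup>2 / 8) / \<bar>t\<bar> \<le> 8 * exp (\<nu> / 2) / \<bar>t\<bar>"
  proof (rule divide_right_mono)
    have "\<sigma>\<^sup>2 \<le> 1" using \<sigma> by (simp add: power_le_one)
    then have "exp (\<sigma>\<^sup>2 / 8) \<le> exp (ln 2)" using ln2_ge_two_thirds by (subst exp_le_cancel_iff) auto
    then show "4 * exp (\<nu> / 2 + \<sigma>\<^sup>2 / 8) \<le> 8 * exp (\<nu> / 2)" by (simp add: exp_add)
  qed simp
  finally have "norm (central_sum \<sigma> \<nu> t) \<le> 8 * exp (\<nu> / 2) / \<bar>t\<bar> + 2 * (C + 2) / \<sigma> * (1 + \<bar>t\<bar>) powr p + 3" by simp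
  \<comment> \<open>The additive 3, made of the 1 from the averaging and the 2 from the discarded
    terms, is absorbed: 2 (C + 2) + 3 = 2 C + 7.\<close>
  moreover have "1 \<le> 1 / \<sigma> * (1 + \<bar>t\<bar>) powr p"
    using \<sigma> p mult_mono[of 1 "1 / \<sigma>" 1 "(1 + \<bar>t\<bar>) powr p"] by (simp add: ge_one_powr_ge_zero)
  moreover have "(2 * C + 7) / \<sigma> * (1 + \<bar>t\<bar>) powr p = 2 * (C + 2) / \<sigma> * (1 + \<bar>t\<bar>) powr p + 3 * (1 / \<sigma> * (1 + \<bar>t\<bar>) powr p)"
    using \<sigma> by (simp add: divide_simps) (simp add: algebra_simps)
  ultimately show ?thesis by linarith
qed

section \<open>Triples of factors and the two smoothed counts\<close>

definition triples :: "real \<Rightarrow> (nat \<times> nat \<times> nat) set" where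
  "triples \<nu> = central_range \<nu> \<times> central_range \<nu> \<times> central_range \<nu>"

definition triple_coeff :: "real \<Rightarrow> real \<Rightarrow> nat \<times> nat \<times> nat \<Rightarrow> real" where
  "triple_coeff \<sigma> \<nu> = (\<lambda>(a, b, c). gauss_coeff \<sigma> \<nu> a * gauss_coeff \<sigma> \<nu> b * gauss_coeff \<sigma> \<nu> c)"

definition triple_log :: "nat \<times> nat \<times> nat \<Rightarrow> real" where
  "triple_log = (\<lambda>(a, b, c). ln (real a) + ln (real b) + ln (real c))"

lemma sum_triples_cis:
  "(\<Sum>j\<in>triples \<nu>. complex_of_real (triple_coeff \<sigma> \<nu> j) * cis (- t * triple_log j)) = central_sum \<sigma> \<nu> t ^ 3"
proof -
  have "(\<Sum>j\<in>triples \<nu>. complex_of_real (triple_coeff \<sigma> \<nu> j) * cis (- t * triple_log j)) =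
    (\<Sum>a\<in>central_range \<nu>. \<Sum>b\<in>central_range \<nu>. \<Sum>c\<in>central_range \<nu>.
      (of_real (gauss_coeff \<sigma> \<nu> a) * cis (- t * ln (real a))) *
      ((of_real (gauss_coeff \<sigma> \<nu> b) * cis (- t * ln (real b))) * (of_real (gauss_coeff \<sigma> \<nu> c) * cis (- t * ln (real c)))))"
    unfolding triples_def sum.cartesian_product[symmetric] sum.cartesian_product'
    by (intro sum.cong refl) (simp add: triple_coeff_def triple_log_def cis_mult[symmetric] distrib_left algebra_simps cis_mult)
  also have "\<dots> = central_sum \<sigma> \<nu> t ^ 3"
    unfolding central_sum_def power3_eq_cube sum_distrib_left[symmetric] sum_distrib_right[symmetric] by (simp add: mult_ac)
  finally show ?thesis .
qed

text \<open>The variable \<open>u\<close> stands for ln x. Both densities have mass one, so the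
  difference cancels the contribution of frequency 0, where the Dirichlet polynomial is
  large.\<close>

definition smoothed_difference :: "real \<Rightarrow> real \<Rightarrow> real \<Rightarrow> real \<Rightarrow> real \<Rightarrow> real" where
  "smoothed_difference \<delta> \<delta>\<^sub>0 \<sigma> \<nu> u = (\<Sum>j\<in>triples \<nu>. triple_coeff \<sigma> \<nu> j *
     (normal_density 0 \<delta> (u - triple_log j) - normal_density 0 \<delta>\<^sub>0 (u - triple_log j)))"

section \<open>The mean square of the difference of two scales\<close>

lemma gaussian_difference_bounds:
  fixes \<delta> \<delta>\<^sub>0 t :: real
  assumes "0 < \<delta>" "\<delta> \<le> \<delta>\<^sub>0"
  defines "g \<equiv> exp (- (\<delta> * t)\<^sup>2 / 2) - exp (- (\<delta>\<^sub>0 * t)\<^sup>2 / 2)"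
  shows "g\<^sup>2 \<le> \<delta>\<^sub>0 ^ 4 * t ^ 4" "g\<^sup>2 \<le> exp (- (\<delta> * t)\<^sup>2)"
proof -
  have "(\<delta> * t)\<^sup>2 \<le> (\<delta>\<^sub>0 * t)\<^sup>2"
    unfolding power_mult_distrib using assms by (intro mult_right_mono power_mono) auto
  then have g0: "g \<ge> 0" unfolding g_def by simp
  have "1 - (\<delta>\<^sub>0 * t)\<^sup>2 / 2 \<le> exp (- (\<delta>\<^sub>0 * t)\<^sup>2 / 2)"
    using exp_ge_add_one_self[of "- (\<delta>\<^sub>0 * t)\<^sup>2 / 2"] by simp
  moreover have "exp (- (\<delta> * t)\<^sup>2 / 2) \<le> 1" by simp
  ultimately have "g \<le> (\<delta>\<^sub>0 * t)\<^sup>2 / 2" unfolding g_def by linarith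
  also have "\<dots> \<le> (\<delta>\<^sub>0 * t)\<^sup>2" by simp
  finally have "g\<^sup>2 \<le> ((\<delta>\<^sub>0 * t)\<^sup>2)\<^sup>2" using g0 by (intro power_mono)
  then show "g\<^sup>2 \<le> \<delta>\<^sub>0 ^ 4 * t ^ 4" by (simp add: power_mult_distrib)
  have "g \<le> exp (- (\<delta> * t)\<^sup>2 / 2)" unfolding g_def by simp
  then have "g\<^sup>2 \<le> (exp (- (\<delta> * t)\<^sup>2 / 2))\<^sup>2" using g0 by (intro power_mono)
  also have "\<dots> = exp (- (\<delta> * t)\<^sup>2)" by (simp add: exp_double[symmetric])
  finally show "g\<^sup>2 \<le> exp (- (\<delta> * t)\<^sup>2)" .
qed

lemma integral_inverse_1_plus_square:
  "has_bochner_integral lborel (\<lambda>t::real. inverse (1 + t\<^sup>2)) pi"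
  using integrable_inverse_1_plus_square LBINT_inverse_1_plus_square
  by (simp add: has_bochner_integral_iff set_integrable_def interval_lebesgue_integral_def set_lebesgue_integral_def)

text \<open>Half of the Gaussian exponent pays for the polynomial growth: with x = \<delta> |t| one
  has 1 + |t| \<le> (1 + x)/\<delta> and 1 + x \<le> 2 exp (x^2/2).\<close>

lemma gaussian_moment_bound:
  fixes \<delta> q :: real
  assumes \<delta>: "0 < \<delta>" "\<delta> \<le> 1" and q: "0 \<le> q" "q \<le> 1"
  shows "exp (- (\<delta> * t)\<^sup>2) * (1 + \<bar>t\<bar>) powr q \<le> 2 * \<delta> powr (- q) * exp (- (\<delta> * t)\<^sup>2 / 2)"
proof -
  define x where "x = \<delta> * \<bar>t\<bar>"
  have "1 + \<bar>t\<bar> \<le> (1 + x) / \<delta>" using \<delta> by (simp add: x_def field_simps)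
  then have "(1 + \<bar>t\<bar>) powr q \<le> ((1 + x) / \<delta>) powr q" using q by (intro powr_mono2) auto
  also have "\<dots> = (1 + x) powr q * \<delta> powr (- q)" using \<delta> by (simp add: powr_divide powr_minus_divide x_def)
  also have "\<dots> \<le> (1 + x) * \<delta> powr (- q)"
    using powr_mono[of q 1 "1 + x"] q \<delta> by (intro mult_right_mono) (auto simp: x_def)
  also have "1 + x \<le> 2 * exp (x\<^sup>2 / 2)"
  proof -
    have "1 + x \<le> 2 * (1 + x\<^sup>2 / 2)" using zero_le_power2[of "x - 1/2"] by (simp add: power2_eq_square algebra_simps)
    also have "\<dots> \<le> 2 * exp (x\<^sup>2 / 2)" by (intro mult_left_mono exp_ge_add_one_self) auto
    finally show ?thesis .
  qed
  finally have "(1 + \<bar>t\<bar>) powr q \<le> 2 * exp (x\<^sup>2 / 2) * \<delta> powr (- q)" by (simp add: mult_right_mono)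
  then have "exp (- (\<delta> * t)\<^sup>2) * (1 + \<bar>t\<bar>) powr q \<le> exp (- (\<delta> * t)\<^sup>2) * (2 * exp (x\<^sup>2 / 2) * \<delta> powr (- q))"
    by (intro mult_left_mono) auto
  also have "\<dots> = 2 * \<delta> powr (- q) * (exp (- (\<delta> * t)\<^sup>2) * exp (x\<^sup>2 / 2))" by simp
  also have "exp (- (\<delta> * t)\<^sup>2) * exp (x\<^sup>2 / 2) = exp (- (\<delta> * t)\<^sup>2 / 2)"
    by (simp add: x_def exp_add[symmetric] power_mult_distrib)
  finally show ?thesis .
qed

text \<open>Up to T the polynomial is bounded trivially and the kernel supplies the saving; beyond T
  the pole term decays like 1/|t| and the zeta term is paid for by the Gaussian cut-off at
  1/\<delta>. The split point stays free, to be balanced against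
  \<open>\<delta>\<^sub>0\<close>.\<close>

lemma variance_bound:
  assumes zeta: "\<And>\<tau>. norm (zeta (1/2 + \<i> * of_real \<tau>)) \<le> C * (\<bar>\<tau>\<bar> + 1) powr p"
    and p: "0 \<le> p" "6 * p \<le> 1" and C: "C \<ge> 0" and \<sigma>: "0 < \<sigma>" "\<sigma> \<le> 1" and \<nu>: "\<nu> \<ge> 0"
    and \<sigma>\<nu>: "2 + 8 * \<nu> \<le> 1 / (8 * \<sigma>\<^sup>2)"
    and \<delta>: "0 < \<delta>" "\<delta> \<le> \<delta>\<^sub>0" "\<delta>\<^sub>0 \<le> 1" and T: "T \<ge> 1"
  shows "integrable lborel (\<lambda>u. (smoothed_difference \<delta> \<delta>\<^sub>0 \<sigma> \<nu> u)\<^sup>2)"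
    and "(LINT u|lborel. (smoothed_difference \<delta> \<delta>\<^sub>0 \<sigma> \<nu> u)\<^sup>2) \<le>
      2 ^ 25 * exp (3 * \<nu>) * (\<delta>\<^sub>0 ^ 4 * T ^ 6 + 1 / T ^ 4) + 2 ^ 7 * (2 * C + 7) ^ 6 / \<sigma> ^ 6 * \<delta> powr (-1 - 6 * p)"
proof -
  define W where "W t = (exp (- (\<delta> * t)\<^sup>2 / 2) - exp (- (\<delta>\<^sub>0 * t)\<^sup>2 / 2))\<^sup>2 * norm (central_sum \<sigma> \<nu> t ^ 3) ^ 2" for t
  have \<delta>0: "\<delta>\<^sub>0 > 0" using \<delta> by simp
  note pl = gaussian_plancherel[OF \<delta>(1) \<delta>0, where A = "triples \<nu>" and c = "triple_coeff \<sigma> \<nu>" and l = triple_log,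
      folded smoothed_difference_def, unfolded sum_triples_cis, folded W_def]
  show "integrable lborel (\<lambda>u. (smoothed_difference \<delta> \<delta>\<^sub>0 \<sigma> \<nu> u)\<^sup>2)" by (rule pl(1))
  \<comment> \<open>The factor 2^25 is 64 * 8^6 * 2, needed for |t| > T; below T, 4^6 * 2 would do.
    In \<open>B\<close>, 2^7 is 64 * 2.\<close>
  define A where "A = 2 ^ 25 * exp (3 * \<nu>) * (\<delta>\<^sub>0 ^ 4 * T ^ 6 + 1 / T ^ 4)"
  define B where "B = 2 ^ 7 * ((2 * C + 7) / \<sigma>) ^ 6 * \<delta> powr (- (6 * p))"
  have A0: "A \<ge> 0" using T by (simp add: A_def)
  have B0: "B \<ge> 0" using C \<sigma> by (simp add: B_def)
  have W: "W t \<le> A * inverse (1 + t\<^sup>2) + B * exp (- (\<delta> * t)\<^sup>2 / 2)" for t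
  proof (cases "\<bar>t\<bar> \<le> T")
    case True
    have "norm (central_sum \<sigma> \<nu> t) ^ 6 \<le> (4 * exp (\<nu> / 2)) ^ 6"
      by (intro power_mono norm_central_sum_trivial) simp
    also have "\<dots> = 4096 * exp (3 * \<nu>)" by (simp add: power_mult_distrib exp_of_nat_mult[symmetric])
    finally have 1: "norm (central_sum \<sigma> \<nu> t) ^ 6 \<le> 4096 * exp (3 * \<nu>)" .
    have "W t = (exp (- (\<delta> * t)\<^sup>2 / 2) - exp (- (\<delta>\<^sub>0 * t)\<^sup>2 / 2))\<^sup>2 * norm (central_sum \<sigma> \<nu> t) ^ 6"
      by (simp add: W_def norm_power flip: power_mult)
    also have "\<dots> \<le> (\<delta>\<^sub>0 ^ 4 * t ^ 4) * (4096 * exp (3 * \<nu>))"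
      by (intro mult_mono gaussian_difference_bounds \<delta> 1) auto
    \<comment> \<open>Two powers of T are given up for the factor
      \<open>inverse (1 + t\<^sup>2)\<close>, an integrable majorant shared with the range beyond
      T.\<close>
    also have "t ^ 4 \<le> 2 * T ^ 6 * inverse (1 + t\<^sup>2)"
    proof -
      have t4: "t ^ 4 \<le> T ^ 4" using True power_mono[of "\<bar>t\<bar>" T 4] by (simp add: power_even_abs)
      have t2: "1 + t\<^sup>2 \<le> 2 * T\<^sup>2" 
      proof -
        have "t\<^sup>2 \<le> T\<^sup>2" using True power_mono[of "\<bar>t\<bar>" T 2] by simp
        moreover have "1 \<le> T\<^sup>2" by (rule one_le_power[OF T])
        ultimately show ?thesis by linarith
      qed
      have "t ^ 4 * (1 + t\<^sup>2) \<le> T ^ 4 * (2 * T\<^sup>2)" using t4 t2 by (intro mult_mono) auto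
      also have "\<dots> = 2 * T ^ 6" by (simp flip: power_add)
      finally show ?thesis by (simp add: field_simps add_pos_nonneg)
    qed
    also have "\<delta>\<^sub>0 ^ 4 * (2 * T ^ 6 * inverse (1 + t\<^sup>2)) * (4096 * exp (3 * \<nu>)) =
       (8192 * exp (3 * \<nu>) * (\<delta>\<^sub>0 ^ 4 * T ^ 6)) * inverse (1 + t\<^sup>2)" by simp
    also have "\<dots> \<le> A * inverse (1 + t\<^sup>2)"
      unfolding A_def using T by (intro mult_right_mono mult_mono) auto
    also have "\<dots> \<le> A * inverse (1 + t\<^sup>2) + B * exp (- (\<delta> * t)\<^sup>2 / 2)"
      using B0 by simp
    finally show ?thesis using \<delta>0 by (simp add: mult_left_mono mult_right_mono)
  next
    case False
    then have t0: "t \<noteq> 0" "\<bar>t\<bar> \<ge> 1" using T by auto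
    define a where "a = 8 * exp (\<nu> / 2) / \<bar>t\<bar>"
    define b where "b = (2 * C + 7) / \<sigma> * (1 + \<bar>t\<bar>) powr p"
    have ab: "a \<ge> 0" "b \<ge> 0" using C \<sigma> by (auto simp: a_def b_def)
    have "norm (central_sum \<sigma> \<nu> t) \<le> a + b"
      unfolding a_def b_def using p by (intro norm_central_sum_le[OF zeta _ _ C \<sigma> \<nu> t0(1) \<sigma>\<nu>]) auto
    also have "\<dots> \<le> 2 * max a b" by simp
    finally have "norm (central_sum \<sigma> \<nu> t) ^ 6 \<le> (2 * max a b) ^ 6" by (intro power_mono) auto
    also have "\<dots> = 64 * max a b ^ 6" by (simp add: power_mult_distrib)
    also have "max a b ^ 6 \<le> a ^ 6 + b ^ 6" using ab by (auto simp: max_def)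
    finally have 1: "norm (central_sum \<sigma> \<nu> t) ^ 6 \<le> 64 * (a ^ 6 + b ^ 6)" by simp
    have "W t = (exp (- (\<delta> * t)\<^sup>2 / 2) - exp (- (\<delta>\<^sub>0 * t)\<^sup>2 / 2))\<^sup>2 * norm (central_sum \<sigma> \<nu> t) ^ 6"
      by (simp add: W_def norm_power flip: power_mult)
    also have "\<dots> \<le> exp (- (\<delta> * t)\<^sup>2) * (64 * (a ^ 6 + b ^ 6))"
      by (intro mult_mono gaussian_difference_bounds \<delta> 1) auto
    also have "\<dots> = exp (- (\<delta> * t)\<^sup>2) * (64 * a ^ 6) + 64 * (exp (- (\<delta> * t)\<^sup>2) * b ^ 6)"
      by (simp add: algebra_simps)
    also have "exp (- (\<delta> * t)\<^sup>2) * (64 * a ^ 6) \<le> 1 * (64 * a ^ 6)"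
      using ab by (intro mult_right_mono) auto
    also have "a ^ 6 = 2 ^ 18 * exp (3 * \<nu>) / \<bar>t\<bar> ^ 6"
      by (simp add: a_def power_mult_distrib power_divide exp_of_nat_mult[symmetric])
    also have "1 * (64 * (2 ^ 18 * exp (3 * \<nu>) / \<bar>t\<bar> ^ 6)) = 2 ^ 24 * exp (3 * \<nu>) * (1 / \<bar>t\<bar> ^ 6)" by simp
    also have "1 / \<bar>t\<bar> ^ 6 \<le> 1 / T ^ 4 * (2 * inverse (1 + t\<^sup>2))"
    proof -
      have "1 / \<bar>t\<bar> ^ 6 = 1 / \<bar>t\<bar> ^ 4 * (1 / t\<^sup>2)" 
      proof -
        have "\<bar>t\<bar> ^ 6 = \<bar>t\<bar> ^ 4 * \<bar>t\<bar>\<^sup>2" by (simp only: power_add[symmetric]) simp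
        then show ?thesis by simp
      qed
      also have "\<dots> \<le> 1 / T ^ 4 * (2 * inverse (1 + t\<^sup>2))"
      proof (rule mult_mono)
        show "1 / \<bar>t\<bar> ^ 4 \<le> 1 / T ^ 4" using False T by (intro divide_left_mono power_mono) auto
        have "1 \<le> t\<^sup>2" using t0 power_mono[of 1 "\<bar>t\<bar>" 2] by simp
        then show "1 / t\<^sup>2 \<le> 2 * inverse (1 + t\<^sup>2)" by (simp add: divide_simps add_pos_pos)
      qed (use T in auto)
      finally show ?thesis .
    qed
    also have "2 ^ 24 * exp (3 * \<nu>) * (1 / T ^ 4 * (2 * inverse (1 + t\<^sup>2))) = 2 ^ 25 * exp (3 * \<nu>) * (1 / T ^ 4) * inverse (1 + t\<^sup>2)"
      by simp
    also have "\<dots> \<le> A * inverse (1 + t\<^sup>2)"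
      unfolding A_def using T by (intro mult_right_mono mult_left_mono) auto
    also have "64 * (exp (- (\<delta> * t)\<^sup>2) * b ^ 6) = 64 * ((2 * C + 7) / \<sigma>) ^ 6 * (exp (- (\<delta> * t)\<^sup>2) * (1 + \<bar>t\<bar>) powr (6 * p))"
      unfolding b_def power_mult_distrib by (simp add: powr_power mult_ac)
    also have "\<dots> \<le> 64 * ((2 * C + 7) / \<sigma>) ^ 6 * (2 * \<delta> powr (- (6 * p)) * exp (- (\<delta> * t)\<^sup>2 / 2))"
      using p \<delta> C \<sigma> by (intro mult_left_mono gaussian_moment_bound) auto
    also have "\<dots> = B * exp (- (\<delta> * t)\<^sup>2 / 2)" by (simp add: B_def)
    finally show ?thesis by simp
  qed
  have g: "has_bochner_integral lborel (\<lambda>t. exp (- (\<delta> * t)\<^sup>2 / 2)) (2 * pi * normal_density 0 \<delta> 0)"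
    using gaussian_cos_integral[OF \<delta>(1), of 0] by simp
  have h: "has_bochner_integral lborel (\<lambda>t. A * inverse (1 + t\<^sup>2) + B * exp (- (\<delta> * t)\<^sup>2 / 2)) (A * pi + B * (2 * pi * normal_density 0 \<delta> 0))"
    by (intro has_bochner_integral_add has_bochner_integral_mult_right integral_inverse_1_plus_square g)
  have "(LINT t|lborel. W t) \<le> A * pi + B * (2 * pi * normal_density 0 \<delta> 0)"
    using integral_mono[OF pl(2) _ W] h by (simp add: has_bochner_integral_iff)
  then have "(LINT t|lborel. W t) / (2 * pi) \<le> (A * pi + B * (2 * pi * normal_density 0 \<delta> 0)) / (2 * pi)"
    by (intro divide_right_mono) auto
  also have "\<dots> = A / 2 + B * normal_density 0 \<delta> 0"
    by (simp add: add_divide_distrib)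
  also have "A / 2 \<le> A" using A0 by simp
  also have "B * normal_density 0 \<delta> 0 \<le> B * (1 / \<delta>)"
  proof (rule mult_left_mono[OF _ B0])
    have "sqrt (2 * pi) \<ge> 1" using pi_ge_two by simp
    then have "1 / (sqrt (2 * pi) * \<delta>) \<le> 1 / (1 * \<delta>)" using \<delta> by (intro divide_left_mono mult_right_mono) auto
    then show "normal_density 0 \<delta> 0 \<le> 1 / \<delta>"
      using \<delta> by (simp add: normal_density_def real_sqrt_mult)
  qed
  also have "B * (1 / \<delta>) = 2 ^ 7 * (2 * C + 7) ^ 6 / \<sigma> ^ 6 * \<delta> powr (-1 - 6 * p)"
    using \<delta> by (simp add: B_def power_divide powr_diff powr_minus_divide field_simps)
  finally show "(LINT u|lborel. (smoothed_difference \<delta> \<delta>\<^sub>0 \<sigma> \<nu> u)\<^sup>2) \<le>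
      2 ^ 25 * exp (3 * \<nu>) * (\<delta>\<^sub>0 ^ 4 * T ^ 6 + 1 / T ^ 4) + 2 ^ 7 * (2 * C + 7) ^ 6 / \<sigma> ^ 6 * \<delta> powr (-1 - 6 * p)"
    unfolding pl(3) A_def by simp
qed

section \<open>Counting triples at the two scales\<close>

text \<open>Markov's inequality in the variable u = ln x; the Jacobian e^u is at most 2Y on the
  range of \<open>E\<close>.\<close>

lemma measure_le_integral_log:
  fixes G :: "real \<Rightarrow> real"
  assumes E: "E \<in> sets borel" "E \<subseteq> {Y..2*Y}" and Y: "Y > 0" and G: "integrable lborel G" "\<And>u. 0 \<le> G u"
    and m: "m > 0" "\<And>x. x \<in> E \<Longrightarrow> m \<le> G (ln x)"
  shows "measure lebesgue E \<le> 2 * Y / m * (LINT u|lborel. G u)"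
proof -
  have "emeasure lborel E = (\<integral>\<^sup>+x. ennreal (indicator E x * indicator {exp (ln Y)..exp (ln (2*Y))} x) \<partial>lborel)"
  proof -
    have "emeasure lborel E = (\<integral>\<^sup>+x. indicator E x \<partial>lborel)" using E by simp
    also have "\<dots> = (\<integral>\<^sup>+x. ennreal (indicator E x * indicator {exp (ln Y)..exp (ln (2*Y))} x) \<partial>lborel)"
      using E Y by (intro nn_integral_cong) (auto simp: indicator_def)
    finally show ?thesis .
  qed
  also have "\<dots> = (\<integral>\<^sup>+u. ennreal (indicator E (exp u) * exp u * indicator {ln Y..ln (2*Y)} u) \<partial>lborel)"
    using E Y by (intro nn_integral_substitution)
      (auto intro!: derivative_eq_intros continuous_intros simp: set_borel_measurable_def)
  also have "\<dots> \<le> (\<integral>\<^sup>+u. ennreal (2 * Y / m * G u) \<partial>lborel)"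
  proof (intro nn_integral_mono ennreal_leI)
    fix u :: real
    show "indicator E (exp u) * exp u * indicator {ln Y..ln (2*Y)} u \<le> 2 * Y / m * G u"
    proof (cases "exp u \<in> E")
      case True
      then have "exp u \<le> 2 * Y" using E by auto
      then have "exp u * m \<le> 2 * Y * G u" using m(2)[OF True] m(1) Y by (intro mult_mono) auto
      then have "exp u \<le> 2 * Y / m * G u" using m(1) by (simp add: field_simps)
      moreover have "0 \<le> 2 * Y / m * G u" using m(1) Y G(2) by simp
      ultimately show ?thesis using True by (simp add: indicator_def)
    next
      case False
      then show ?thesis using Y m G by simp
    qed
  qed
  also have "\<dots> = ennreal (2 * Y / m * (LINT u|lborel. G u))"
    using G Y m by (subst nn_integral_eq_integral) (auto intro!: integrable_mult_right)
  finally have "measure lborel E \<le> 2 * Y / m * (LINT u|lborel. G u)"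
    unfolding measure_def using G Y m by (intro enn2real_leI) (auto intro!: integral_nonneg_AE mult_nonneg_nonneg)
  then show ?thesis using E by simp
qed

lemma card_nat_interval_ge:
  assumes "0 \<le> lo" "lo \<le> hi"
  shows "finite {n::nat. lo \<le> real n \<and> real n \<le> hi}" "hi - lo - 1 \<le> real (card {n::nat. lo \<le> real n \<and> real n \<le> hi})"
proof -
  have eq: "{n::nat. lo \<le> real n \<and> real n \<le> hi} = {nat \<lceil>lo\<rceil>..nat \<lfloor>hi\<rfloor>}"
    using assms by (auto simp: le_nat_floor nat_ceiling_le_eq) (meson of_nat_floor of_nat_le_iff order_trans)
  show "finite {n::nat. lo \<le> real n \<and> real n \<le> hi}" unfolding eq by simp
  have "hi - lo - 1 \<le> real (Suc (nat \<lfloor>hi\<rfloor>)) - real (nat \<lceil>lo\<rceil>)" using assms by linarith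
  also have "\<dots> \<le> real (Suc (nat \<lfloor>hi\<rfloor>) - nat \<lceil>lo\<rceil>)" by linarith
  finally show "hi - lo - 1 \<le> real (card {n::nat. lo \<le> real n \<and> real n \<le> hi})" unfolding eq by simp
qed

lemma finite_triples [simp]: "finite (triples \<nu>)"
  by (simp add: triples_def)

lemma triple_coeff_nonneg: "triple_coeff \<sigma> \<nu> j \<ge> 0"
  by (auto simp: triple_coeff_def gauss_coeff_nonneg split: prod.splits)

text \<open>Every coefficient is bounded by 1 and there are at most 8 N^3 triples. These polynomial
  losses are harmless, since the exponential factor will beat every power of Y.\<close>

lemma fine_sum_le:
  assumes \<delta>: "\<delta> > 0" and \<kappa>: "\<kappa> \<ge> 0" and far: "\<And>j. j \<in> triples \<nu> \<Longrightarrow> \<kappa> \<le> \<bar>u - triple_log j\<bar>"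
  shows "(\<Sum>j\<in>triples \<nu>. triple_coeff \<sigma> \<nu> j * normal_density 0 \<delta> (u - triple_log j)) \<le>
    8 * exp (3 * \<nu>) / \<delta> * exp (- (\<kappa> / \<delta>)\<^sup>2 / 2)"
proof -
  have "(\<Sum>j\<in>triples \<nu>. triple_coeff \<sigma> \<nu> j * normal_density 0 \<delta> (u - triple_log j)) \<le>
     (\<Sum>j\<in>triples \<nu>. 1 / \<delta> * exp (- (\<kappa> / \<delta>)\<^sup>2 / 2))"
  proof (rule sum_mono)
    fix j assume j: "j \<in> triples \<nu>"
    have g: "gauss_coeff \<sigma> \<nu> n \<le> 1" if "n \<in> central_range \<nu>" for n
      using central_range_pos[OF that] powr_mono[of "-1/2" 0 "real n"] unfolding gauss_coeff_def
      by (intro mult_le_one) auto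
    have c1: "triple_coeff \<sigma> \<nu> j \<le> 1"
      using j by (auto simp: triples_def triple_coeff_def intro!: mult_le_one g gauss_coeff_nonneg mult_nonneg_nonneg)
    have n: "normal_density 0 \<delta> (u - triple_log j) = 1 / (sqrt (2 * pi) * \<delta>) * exp (- ((u - triple_log j) / \<delta>)\<^sup>2 / 2)"
      using \<delta> by (simp add: normal_density_def real_sqrt_mult power_divide)
    have "(\<kappa> / \<delta>)\<^sup>2 \<le> ((u - triple_log j) / \<delta>)\<^sup>2"
      using far[OF j] \<kappa> \<delta> by (simp add: power_divide divide_right_mono abs_le_square_iff[symmetric])
    then have "exp (- ((u - triple_log j) / \<delta>)\<^sup>2 / 2) \<le> exp (- (\<kappa> / \<delta>)\<^sup>2 / 2)" by simp
    moreover have "1 / (sqrt (2 * pi) * \<delta>) \<le> 1 / \<delta>"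
    proof -
      have "sqrt (2 * pi) \<ge> 1" using pi_ge_two by simp
      then have "1 / (sqrt (2 * pi) * \<delta>) \<le> 1 / (1 * \<delta>)" using \<delta> by (intro divide_left_mono mult_right_mono) auto
      then show ?thesis by simp
    qed
    ultimately have "normal_density 0 \<delta> (u - triple_log j) \<le> 1 / \<delta> * exp (- (\<kappa> / \<delta>)\<^sup>2 / 2)"
      unfolding n using \<delta> by (intro mult_mono) auto
    then have "triple_coeff \<sigma> \<nu> j * normal_density 0 \<delta> (u - triple_log j) \<le> 1 * (1 / \<delta> * exp (- (\<kappa> / \<delta>)\<^sup>2 / 2))"
      using c1 by (intro mult_mono) auto
    then show "triple_coeff \<sigma> \<nu> j * normal_density 0 \<delta> (u - triple_log j) \<le> 1 / \<delta> * exp (- (\<kappa> / \<delta>)\<^sup>2 / 2)" by simp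
  qed
  also have "\<dots> = real (card (triples \<nu>)) * (1 / \<delta> * exp (- (\<kappa> / \<delta>)\<^sup>2 / 2))" by simp
  also have "real (card (triples \<nu>)) \<le> 8 * exp (3 * \<nu>)"
  proof -
    have "real (card (triples \<nu>)) = real (card (central_range \<nu>)) ^ 3"
      by (simp add: triples_def card_cartesian_product power3_eq_cube)
    also have "\<dots> \<le> (2 * exp \<nu>) ^ 3" by (intro power_mono card_central_range) simp
    also have "\<dots> = 8 * exp (3 * \<nu>)" by (simp add: power_mult_distrib exp_of_nat_mult[symmetric])
    finally show ?thesis .
  qed
  finally show ?thesis using \<delta> by (simp add: mult_right_mono divide_right_mono)
qed

text \<open>Choose a and b freely just above N and let c complete the product to within a factor 1 +
  \<delta> of x. The range for c has length about N \<delta>, so it is sure to contain integers only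
  at a coarse scale. The number of triples is proportional to \<delta> and the density to
  1/\<delta>, so \<delta> cancels. The constant 768 is 8 * 8 * 4 * 3. In exp (-8), the three weights
  take 6, the shift of the product away from N^3 takes 1, and the density takes 1.\<close>

lemma coarse_sum_ge:
  assumes \<sigma>: "0 < \<sigma>" "\<sigma> \<le> 1/16" and \<delta>: "0 < \<delta>" "\<delta> \<le> \<sigma>" and \<kappa>: "0 \<le> \<kappa>" "\<kappa> \<le> \<delta>"
    and big: "8 \<le> exp \<nu> * \<sigma>" "4 \<le> exp \<nu> * \<delta>" and x: "exp (3 * \<nu>) \<le> x" "x \<le> exp (3 * \<nu>) * (1 + \<sigma>)"
  shows "exp (-8) / 768 * \<sigma>\<^sup>2 * exp (3 * \<nu> / 2) \<le>
    (\<Sum>j\<in>triples \<nu>. triple_coeff \<sigma> \<nu> j * normal_density 0 \<delta> (ln x + \<kappa> - triple_log j))"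
proof -
  define N where "N = exp \<nu>"
  have N: "N > 0" by (simp add: N_def)
  have x0: "x > 0" using x(1) exp_gt_zero[of "3 * \<nu>"] by linarith
  \<comment> \<open>With \<sigma>/4 here, ln (x/(a b)) stays between \<nu> - \<sigma>/2 and \<nu> +
    \<sigma>, so c too is within 2 \<sigma> of \<nu> on the logarithmic scale.\<close>
  define A where "A = {n::nat. N \<le> real n \<and> real n \<le> N * (1 + \<sigma> / 4)}"
  define z where "z a b = x / (real a * real b)" for a b :: nat
  define B where "B a b = {n::nat. z a b \<le> real n \<and> real n \<le> z a b * (1 + \<delta>)}" for a b
  define Q where "Q = (SIGMA a:A. SIGMA b:A. B a b)"
  have lnx: "0 \<le> ln x - 3 * \<nu>" "ln x - 3 * \<nu> \<le> \<sigma>"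
  proof -
    show "0 \<le> ln x - 3 * \<nu>" using x(1) x0 by (simp add: ln_ge_iff)
    have "ln x \<le> ln (exp (3 * \<nu>) * (1 + \<sigma>))" using x x0 \<sigma> by (subst ln_le_cancel_iff) auto
    also have "\<dots> = 3 * \<nu> + ln (1 + \<sigma>)" using \<sigma> by (simp add: ln_mult)
    also have "ln (1 + \<sigma>) \<le> \<sigma>" using \<sigma> by (intro ln_add_one_self_le_self) auto
    finally show "ln x - 3 * \<nu> \<le> \<sigma>" by simp
  qed
  have lnA: "a > 0 \<and> 0 \<le> ln (real a) - \<nu> \<and> ln (real a) - \<nu> \<le> \<sigma> / 4" if "a \<in> A" for a
  proof (intro conjI)
    have a: "N \<le> real a" "real a \<le> N * (1 + \<sigma> / 4)" using that by (auto simp: A_def)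
    then show a0: "a > 0" using N by (metis of_nat_0_less_iff order_less_le_trans)
    show "0 \<le> ln (real a) - \<nu>" using a a0 by (simp add: ln_ge_iff N_def)
    have "ln (real a) \<le> ln (N * (1 + \<sigma> / 4))" using a a0 N \<sigma> by (subst ln_le_cancel_iff) auto
    also have "\<dots> = \<nu> + ln (1 + \<sigma> / 4)" using \<sigma> by (simp add: ln_mult N_def)
    also have "ln (1 + \<sigma> / 4) \<le> \<sigma> / 4" using \<sigma> by (intro ln_add_one_self_le_self) auto
    finally show "ln (real a) - \<nu> \<le> \<sigma> / 4" by simp
  qed
  have zpos: "z a b > 0" and lnz: "ln (z a b) = ln x - ln (real a) - ln (real b)" if "a \<in> A" "b \<in> A" for a b
    using lnA[OF that(1)] lnA[OF that(2)] x0 by (auto simp: z_def ln_div ln_mult)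
  have lnB: "c > 0 \<and> ln (z a b) \<le> ln (real c) \<and> ln (real c) \<le> ln (z a b) + \<delta>" if "a \<in> A" "b \<in> A" "c \<in> B a b" for a b c
  proof (intro conjI)
    have c: "z a b \<le> real c" "real c \<le> z a b * (1 + \<delta>)" using that by (auto simp: B_def)
    note zp = zpos[OF that(1,2)]
    show c0: "c > 0" using zp c(1) by (metis of_nat_0_less_iff order_less_le_trans)
    show "ln (z a b) \<le> ln (real c)" using c c0 zp by (subst ln_le_cancel_iff) auto
    have "ln (real c) \<le> ln (z a b * (1 + \<delta>))" using c c0 zp \<delta> by (subst ln_le_cancel_iff) auto
    also have "\<dots> = ln (z a b) + ln (1 + \<delta>)" using \<delta> zp by (simp add: ln_mult)
    also have "ln (1 + \<delta>) \<le> \<delta>" using \<delta> by (intro ln_add_one_self_le_self) auto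
    finally show "ln (real c) \<le> ln (z a b) + \<delta>" by simp
  qed
  \<comment> \<open>Two standard deviations cost a factor exp (-2), and 2 \<sigma> \<le> 1/8 is less
    than the distance 1/4 at which the central range can end.\<close>
  have coeff: "n \<in> central_range \<nu> \<and> exp (- ln (real n) / 2 - 2) \<le> gauss_coeff \<sigma> \<nu> n"
    if "n > 0" "\<bar>ln (real n) - \<nu>\<bar> \<le> 2 * \<sigma>" for n
  proof
    show "n \<in> central_range \<nu>"
      using central_range_log_distance[OF that(1), of \<nu>] that(2) \<sigma> by fastforce
    have "((ln (real n) - \<nu>) / \<sigma>)\<^sup>2 \<le> 2\<^sup>2"
      using that(2) \<sigma> by (intro power2_le_iff_abs_le[THEN iffD2]) (auto simp: field_simps)
    then have "exp (- ln (real n) / 2 - 2) \<le> exp (- ln (real n) / 2 + - ((ln (real n) - \<nu>) / \<sigma>)\<^sup>2 / 2)" by simp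
    also have "\<dots> = gauss_coeff \<sigma> \<nu> n" using that(1) unfolding exp_add by (simp add: gauss_coeff_def powr_def)
    finally show "exp (- ln (real n) / 2 - 2) \<le> gauss_coeff \<sigma> \<nu> n" .
  qed
  have Q: "j \<in> triples \<nu> \<and> exp (-8) / (3 * \<delta>) * exp (- (3 * \<nu> / 2)) \<le> triple_coeff \<sigma> \<nu> j * normal_density 0 \<delta> (ln x + \<kappa> - triple_log j)"
    if jQ: "j \<in> Q" for j
  proof -
    from jQ obtain a b c where j: "j = (a, b, c)" and abc: "a \<in> A" "b \<in> A" "c \<in> B a b" by (auto simp: Q_def)
    note la = lnA[OF abc(1)] note lb = lnA[OF abc(2)] note lc = lnB[OF abc] note lz = lnz[OF abc(1,2)]
    have "\<bar>ln (real a) - \<nu>\<bar> \<le> 2 * \<sigma>" "\<bar>ln (real b) - \<nu>\<bar> \<le> 2 * \<sigma>" "\<bar>ln (real c) - \<nu>\<bar> \<le> 2 * \<sigma>"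
      using la lb lc lz lnx \<sigma> \<delta> by (auto simp: abs_le_iff)
    then have ca: "a \<in> central_range \<nu>" "exp (- ln (real a) / 2 - 2) \<le> gauss_coeff \<sigma> \<nu> a"
      and cb: "b \<in> central_range \<nu>" "exp (- ln (real b) / 2 - 2) \<le> gauss_coeff \<sigma> \<nu> b"
      and cc: "c \<in> central_range \<nu>" "exp (- ln (real c) / 2 - 2) \<le> gauss_coeff \<sigma> \<nu> c"
      using coeff la lb lc by blast+
    have tl: "ln x \<le> triple_log j" "triple_log j \<le> ln x + \<delta>"
      using lc lz by (auto simp: triple_log_def j)
    have "exp (- (3 * \<nu> / 2) - 7) \<le> exp (- triple_log j / 2 - 6)"
      using tl lnx \<sigma> \<delta> by simp
    also have "\<dots> = exp (- ln (real a) / 2 - 2) * exp (- ln (real b) / 2 - 2) * exp (- ln (real c) / 2 - 2)"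
      unfolding exp_add[symmetric] by (simp add: triple_log_def j field_simps)
    also have "\<dots> \<le> triple_coeff \<sigma> \<nu> j"
      unfolding triple_coeff_def j prod.case
      by (intro mult_mono ca cb cc gauss_coeff_nonneg mult_nonneg_nonneg exp_ge_zero)
    finally have 1: "exp (- (3 * \<nu> / 2) - 7) \<le> triple_coeff \<sigma> \<nu> j" .
    define y where "y = ln x + \<kappa> - triple_log j"
    have "\<bar>y\<bar> \<le> \<delta>" using tl \<kappa> by (simp add: y_def abs_le_iff)
    then have "(y / \<delta>)\<^sup>2 \<le> 1\<^sup>2" using \<delta> by (intro power2_le_iff_abs_le[THEN iffD2]) auto
    then have "exp (-1) \<le> exp (- (y / \<delta>)\<^sup>2 / 2)" by simp
    moreover have "1 / (3 * \<delta>) \<le> 1 / (sqrt (2 * pi) * \<delta>)"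
    proof -
      have "sqrt (2 * pi) \<le> 3" using pi_less_4 by (intro real_le_lsqrt) auto
      then show ?thesis using \<delta> by (intro divide_left_mono mult_right_mono) auto
    qed
    ultimately have "1 / (3 * \<delta>) * exp (-1) \<le> 1 / (sqrt (2 * pi) * \<delta>) * exp (- (y / \<delta>)\<^sup>2 / 2)"
      using \<delta> by (intro mult_mono) auto
    also have "\<dots> = normal_density 0 \<delta> y"
      using \<delta> by (simp add: normal_density_def real_sqrt_mult power_divide)
    finally have 2: "1 / (3 * \<delta>) * exp (-1) \<le> normal_density 0 \<delta> y" .
    have "exp (- (3 * \<nu> / 2) - 7) * (1 / (3 * \<delta>) * exp (-1)) \<le> triple_coeff \<sigma> \<nu> j * normal_density 0 \<delta> y"
      using 1 2 \<delta> triple_coeff_nonneg by (intro mult_mono) auto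
    moreover have "exp (- (3 * \<nu> / 2) - 7) * (1 / (3 * \<delta>) * exp (-1)) = exp (-8) / (3 * \<delta>) * exp (- (3 * \<nu> / 2))"
      by (simp add: exp_add[symmetric])
    ultimately have "exp (-8) / (3 * \<delta>) * exp (- (3 * \<nu> / 2)) \<le> triple_coeff \<sigma> \<nu> j * normal_density 0 \<delta> y"
      by metis
    then show ?thesis using ca(1) cb(1) cc(1) unfolding y_def by (simp add: triples_def j)
  qed
  have cardA: "N * \<sigma> / 8 \<le> real (card A)" "finite A"
  proof -
    have "N * (1 + \<sigma> / 4) - N - 1 \<le> real (card A)"
      unfolding A_def using N \<sigma> by (intro card_nat_interval_ge) auto
    moreover have "N * (1 + \<sigma> / 4) - N - 1 = N * \<sigma> / 8 + (N * \<sigma> - 8) / 8" by (simp add: field_simps)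
    ultimately show "N * \<sigma> / 8 \<le> real (card A)" using big(1) unfolding N_def[symmetric] by argo
    show "finite A" unfolding A_def using N \<sigma> by (intro card_nat_interval_ge) auto
  qed
  have cardB: "N * \<delta> / 4 \<le> real (card (B a b))" "finite (B a b)" if "a \<in> A" "b \<in> A" for a b
  proof -
    note zp = zpos[OF that]
    have "ln (z a b) \<ge> \<nu> - \<sigma> / 2" using lnA[OF that(1)] lnA[OF that(2)] lnz[OF that] lnx by linarith
    then have "exp (\<nu> - \<sigma> / 2) \<le> z a b" using zp by (simp add: ln_ge_iff)
    moreover have "N * (1 / 2) \<le> N * exp (- \<sigma> / 2)"
      using exp_ge_add_one_self[of "- \<sigma> / 2"] \<sigma> N by (intro mult_left_mono) auto
    moreover have "N * exp (- \<sigma> / 2) = exp (\<nu> - \<sigma> / 2)" by (simp add: N_def exp_add[symmetric])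
    ultimately have zN: "N / 2 \<le> z a b" by linarith
    have "z a b * (1 + \<delta>) - z a b - 1 \<le> real (card (B a b))"
      unfolding B_def using zp \<delta> by (intro card_nat_interval_ge) auto
    moreover have "N / 2 * \<delta> \<le> z a b * \<delta>" using zN \<delta> by (intro mult_right_mono) auto
    ultimately show "N * \<delta> / 4 \<le> real (card (B a b))" using big by (simp add: N_def algebra_simps)
    show "finite (B a b)" unfolding B_def using zp \<delta> by (intro card_nat_interval_ge) auto
  qed
  have cardQ: "(N * \<sigma> / 8) * ((N * \<sigma> / 8) * (N * \<delta> / 4)) \<le> real (card Q)"
  proof -
    have "(N * \<sigma> / 8) * ((N * \<sigma> / 8) * (N * \<delta> / 4)) \<le> real (card A) * (real (card A) * (N * \<delta> / 4))"
      using cardA N \<sigma> \<delta> by (intro mult_mono) auto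
    also have "\<dots> = (\<Sum>a\<in>A. \<Sum>b\<in>A. N * \<delta> / 4)" by simp
    also have "\<dots> \<le> (\<Sum>a\<in>A. \<Sum>b\<in>A. real (card (B a b)))" by (intro sum_mono cardB)
    also have "\<dots> = real (card Q)" unfolding Q_def
      using cardA(2) cardB(2) by (simp add: card_SigmaI)
    finally show ?thesis .
  qed
  have "exp (-8) / 768 * \<sigma>\<^sup>2 * exp (3 * \<nu> / 2) = (N * \<sigma> / 8) * ((N * \<sigma> / 8) * (N * \<delta> / 4)) * (exp (-8) / (3 * \<delta>) * exp (- (3 * \<nu> / 2)))"
  proof -
    have "N ^ 3 * exp (- (3 * \<nu> / 2)) = exp (3 * \<nu> / 2)"
      by (simp add: N_def exp_of_nat_mult[symmetric] exp_add[symmetric])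
    then show ?thesis using \<delta> by (simp add: power2_eq_square power3_eq_cube field_simps)
  qed
  also have "\<dots> \<le> real (card Q) * (exp (-8) / (3 * \<delta>) * exp (- (3 * \<nu> / 2)))"
    using cardQ \<delta> by (intro mult_right_mono) auto
  also have "\<dots> = (\<Sum>j\<in>Q. exp (-8) / (3 * \<delta>) * exp (- (3 * \<nu> / 2)))" by simp
  also have "\<dots> \<le> (\<Sum>j\<in>Q. triple_coeff \<sigma> \<nu> j * normal_density 0 \<delta> (ln x + \<kappa> - triple_log j))"
    using Q by (intro sum_mono) blast
  also have "\<dots> \<le> (\<Sum>j\<in>triples \<nu>. triple_coeff \<sigma> \<nu> j * normal_density 0 \<delta> (ln x + \<kappa> - triple_log j))"
    using Q by (intro sum_mono2) (auto intro!: mult_nonneg_nonneg triple_coeff_nonneg)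
  finally show ?thesis .
qed

section \<open>Exceptional sets\<close>

text \<open>On the logarithmic scale, [x, x + x^e] covers at least the stretch from ln x to ln x +
  Y^(e - 1)/4, by ln (1 + h) \<ge> h/2 with h \<ge> Y^(e - 1)/2. The products avoid this stretch,
  and the point in question is its midpoint.\<close>

lemma exceptional_set_far:
  assumes e: "0 < e" "e \<le> 1/2" and Y: "Y \<ge> 4" and x: "x \<in> exceptional_set e Y" and j: "j \<in> triples (ln Y / 3)"
  shows "Y powr (e - 1) / 8 \<le> \<bar>ln x + Y powr (e - 1) / 8 - triple_log j\<bar>"
proof -
  obtain a b c where abc: "j = (a, b, c)" by (cases j)
  define N where "N = Y powr (1/3)"
  have N: "exp (ln Y / 3) = N" using Y by (simp add: N_def powr_def)
  have xY: "Y \<le> x" "x \<le> 2 * Y" using x by (auto simp: exceptional_set_def)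
  have Nx: "N \<le> x powr (1/3)" unfolding N_def using xY Y by (intro powr_mono2) auto
  have xN: "x powr (1/3) \<le> 3/2 * N"
  proof -
    have "x powr (1/3) \<le> (2 * Y) powr (1/3)" using xY Y by (intro powr_mono2) auto
    \<comment> \<open>27/8 is the cube of 3/2 and exceeds 2; the bound 3N/2 makes the lower end 3N/4
      of the central range admissible.\<close>
    also have "\<dots> \<le> (27/8 * Y) powr (1/3)" using Y by (intro powr_mono2) auto
    also have "\<dots> = (27/8) powr (1/3) * N" unfolding N_def by (rule powr_mult)
    also have "(27/8 :: real) = (3/2) powr 3" by (simp add: power3_eq_cube)
    also have "((3/2) powr 3) powr (1/3) = (3/2 :: real)" unfolding powr_powr by simp
    finally show ?thesis .
  qed
  have rng: "n > 0 \<and> real n \<in> {x powr (1/3) / 2 .. 2 * x powr (1/3)}" if "n \<in> central_range (ln Y / 3)" for n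
    using central_range_pos[OF that] that Nx xN unfolding central_range_def N by auto
  have abc': "a \<in> central_range (ln Y / 3)" "b \<in> central_range (ln Y / 3)" "c \<in> central_range (ln Y / 3)"
    using j by (auto simp: triples_def abc)
  then have pos: "a > 0" "b > 0" "c > 0" using rng by blast+
  have notin: "real (a * b * c) \<notin> {x .. x + x powr e}"
    using x rng[OF abc'(1)] rng[OF abc'(2)] rng[OF abc'(3)] unfolding exceptional_set_def by blast
  have tl: "triple_log j = ln (real (a * b * c))"
    using pos by (simp add: triple_log_def abc ln_mult)
  have P: "real (a * b * c) > 0" using pos by simp
  have x0: "x > 0" using xY Y by simp
  show ?thesis
  proof (cases "real (a * b * c) < x")
    case True
    then have "triple_log j \<le> ln x" unfolding tl using P x0 by (subst ln_le_cancel_iff) auto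
    then show ?thesis by linarith
  next
    case False
    define h where "h = x powr (e - 1)"
    have "(1/2) * Y powr (e - 1) \<le> 2 powr (e - 1) * Y powr (e - 1)"
      using powr_mono[of "-1" "e - 1" "2::real"] e by (intro mult_right_mono) (auto simp: powr_minus)
    also have "\<dots> = (2 * Y) powr (e - 1)" by (simp add: powr_mult)
    also have "\<dots> \<le> h" unfolding h_def using xY x0 e by (intro powr_mono2') auto
    finally have h1: "(1/2) * Y powr (e - 1) \<le> h" .
    have "h \<le> 4 powr (e - 1)" unfolding h_def using xY Y e by (intro powr_mono2') auto
    also have "\<dots> \<le> 4 powr (-1/2)" using e by (intro powr_mono) auto
    also have "\<dots> = 1/2" by (simp add: powr_minus powr_half_sqrt)
    finally have h2: "h \<le> 1/2" .
    have h0: "h > 0" using x0 by (simp add: h_def)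
    have "x + x powr e = x * (1 + h)"
      using x0 by (simp add: h_def distrib_left powr_diff)
    then have "x * (1 + h) \<le> real (a * b * c)" using False notin by simp
    then have "ln (x * (1 + h)) \<le> triple_log j" unfolding tl using P x0 h0 by (subst ln_le_cancel_iff) auto
    moreover have "ln (x * (1 + h)) = ln x + ln (1 + h)" using x0 h0 by (simp add: ln_mult)
    moreover have "h - h\<^sup>2 \<le> ln (1 + h)" using h0 h2 by (intro ln_one_plus_pos_lower_bound) auto
    moreover have "h * h \<le> h * (1/2)" using h0 h2 by (intro mult_left_mono) auto
    ultimately have "ln x + Y powr (e - 1) / 4 \<le> triple_log j"
      using h1 unfolding power2_eq_square by linarith
    then show ?thesis by linarith
  qed
qed

lemma exceptional_set_borel: "exceptional_set e Y \<in> sets borel"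
  unfolding exceptional_set_def atLeastAtMost_iff by measurable

text \<open>At an exceptional x the two counts differ by at least half of the coarse lower bound,
  which the mean square forbids on a large set. The cap on \<open>a\<close> keeps 48a \<le> 1/2 and
  12a \<le> 1, and leaves 1/3 - 6a positive, so that \<open>\<delta>0\<close> is coarser than
  1/N.\<close>

lemma window_measure_bound:
  fixes a :: real
  assumes lh: lindelof_hypothesis and a: "0 < a" "a \<le> 1/96"
  shows "\<exists>K\<ge>0. eventually (\<lambda>Y. measure lebesgue (exceptional_set (48 * a) Y \<inter> {..Y + Y powr (1 - a)}) \<le> K * Y powr (1 - 2 * a)) at_top"
proof -
  obtain C0 where C0: "\<And>t::real. norm (zeta (1/2 + \<i> * of_real t)) \<le> C0 * (\<bar>t\<bar> + 1) powr (2 * a)"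
    using lh a unfolding lindelof_hypothesis_def by (metis mult_pos_pos zero_less_numeral)
  define C where "C = \<bar>C0\<bar>"
  have zeta: "norm (zeta (1/2 + \<i> * of_real t)) \<le> C * (\<bar>t\<bar> + 1) powr (2 * a)" for t
    by (rule order_trans[OF C0]) (auto simp: C_def intro!: mult_right_mono)
  define c where "c = exp (-8) / (768::real)"
  have c: "c > 0" by (simp add: c_def)
  define K1 where "K1 = 2 ^ 26 + 2 ^ 7 * (2 * C + 7) ^ 6"
  have K1: "K1 \<ge> 0" by (simp add: K1_def C_def)
  \<comment> \<open>\<open>ev1\<close> allows the terms outside the central range to be dropped,
    \<open>ev2\<close> to \<open>ev4\<close> are the size conditions of the coarse count, and
    \<open>ev5\<close> makes the fine count at most half of the coarse lower bound.\<close>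
  have ev1: "eventually (\<lambda>Y::real. 2 + 8 * (ln Y / 3) \<le> 1 / (8 * (Y powr (- a))\<^sup>2)) at_top"
    using a by real_asymp
  have ev2: "eventually (\<lambda>Y::real. Y powr (- a) \<le> 1/16) at_top" using a by real_asymp
  have ev3: "eventually (\<lambda>Y::real. 8 \<le> Y powr (1/3 - a)) at_top" using a by real_asymp
  have ev4: "eventually (\<lambda>Y::real. 4 \<le> Y powr (1/3 - 6 * a)) at_top" using a by real_asymp
  have ev5: "eventually (\<lambda>Y::real. 8 * Y / Y powr (24 * a - 1) * exp (- (Y powr (24 * a) / 8)\<^sup>2 / 2)
      \<le> c / 2 * Y powr (1/2 - 2 * a)) at_top" using a c by real_asymp
  have "eventually (\<lambda>Y. measure lebesgue (exceptional_set (48 * a) Y \<inter> {..Y + Y powr (1 - a)})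
      \<le> 8 / c\<^sup>2 * K1 * Y powr (1 - 2 * a)) at_top"
    using ev1 ev2 ev3 ev4 ev5 eventually_ge_at_top[of 4]
  proof eventually_elim
    case (elim Y)
    define \<nu> \<sigma> \<delta> \<delta>0 T \<kappa> where "\<nu> = ln Y / 3" and "\<sigma> = Y powr (- a)" and "\<delta> = Y powr (24 * a - 1)"
      and "\<delta>0 = Y powr (- (6 * a))" and "T = Y powr (3 * a)" and "\<kappa> = Y powr (48 * a - 1) / 8"
    note defs = \<nu>_def \<sigma>_def \<delta>_def \<delta>0_def T_def \<kappa>_def
    have Y: "Y \<ge> 4" "Y \<ge> 1" "Y > 0" using elim by auto
    have e3: "exp (3 * \<nu>) = Y" using Y by (simp add: \<nu>_def)
    have e1: "exp \<nu> = Y powr (1/3)" using Y by (simp add: \<nu>_def powr_def)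
    have e32: "exp (3 * \<nu> / 2) = Y powr (1/2)" using Y by (simp add: \<nu>_def powr_def)
    have pos: "\<sigma> > 0" "\<delta> > 0" "\<delta>0 > 0" "\<kappa> \<ge> 0" using Y by (auto simp: defs)
    have T: "T \<ge> 1" unfolding T_def using a Y by (intro ge_one_powr_ge_zero) auto
    have \<delta>\<delta>0: "\<delta> \<le> \<delta>0" unfolding defs using a Y by (intro powr_mono) auto
    have \<delta>0\<sigma>: "\<delta>0 \<le> \<sigma>" unfolding defs using a Y by (intro powr_mono) auto
    have \<sigma>: "\<sigma> \<le> 1/16" using elim by (simp add: \<sigma>_def)
    have \<kappa>\<delta>0: "\<kappa> \<le> \<delta>0"
    proof -
      have "Y powr (48 * a - 1) \<le> \<delta>0" unfolding \<delta>0_def using a Y by (intro powr_mono) auto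
      then show ?thesis using pos by (simp add: \<kappa>_def)
    qed
    have \<nu>: "\<nu> \<ge> 0" using Y by (simp add: \<nu>_def)
    have \<sigma>\<nu>: "2 + 8 * \<nu> \<le> 1 / (8 * \<sigma>\<^sup>2)" using elim(1) by (simp only: \<nu>_def \<sigma>_def)
    define F where "F = smoothed_difference \<delta> \<delta>0 \<sigma> \<nu>"
    have p: "0 \<le> 2 * a" "6 * (2 * a) \<le> 1" using a by auto
    have C: "0 \<le> C" by (simp add: C_def)
    have \<sigma>1: "\<sigma> \<le> 1" "\<delta>0 \<le> 1" using \<sigma> \<delta>0\<sigma> by auto
    note vb = variance_bound[OF zeta p C pos(1) \<sigma>1(1) \<nu> \<sigma>\<nu> pos(2) \<delta>\<delta>0 \<sigma>1(2) T, folded F_def]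
    have V: "(LINT u|lborel. (F u)\<^sup>2) \<le> K1 * Y powr (1 - 6 * a)"
    proof -
      have "\<delta>0 ^ 4 * T ^ 6 = Y powr (- (6 * a))"
        using Y by (simp add: defs powr_power powr_add[symmetric])
      moreover have "1 / T ^ 4 \<le> Y powr (- (6 * a))"
      proof -
        have "1 / T ^ 4 = Y powr (- (12 * a))" using Y by (simp add: defs powr_power powr_minus_divide)
        also have "\<dots> \<le> Y powr (- (6 * a))" using Y a by (intro powr_mono) auto
        finally show ?thesis .
      qed
      ultimately have "2 ^ 25 * exp (3 * \<nu>) * (\<delta>0 ^ 4 * T ^ 6 + 1 / T ^ 4) \<le> 2 ^ 25 * Y * (2 * Y powr (- (6 * a)))"
        unfolding e3 using Y by (intro mult_left_mono) auto
      also have "\<dots> = 2 ^ 26 * Y powr (1 - 6 * a)" using Y by (simp add: powr_diff powr_minus_divide)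
      finally have 1: "2 ^ 25 * exp (3 * \<nu>) * (\<delta>0 ^ 4 * T ^ 6 + 1 / T ^ 4) \<le> 2 ^ 26 * Y powr (1 - 6 * a)" .
      have "1 / \<sigma> ^ 6 * \<delta> powr (-1 - 6 * (2 * a)) = Y powr (6 * a + (24 * a - 1) * (-1 - 12 * a))"
      proof -
        have "\<sigma> ^ 6 = Y powr (- (6 * a))" using Y by (simp add: \<sigma>_def powr_power mult.commute)
        then have "1 / \<sigma> ^ 6 = Y powr (6 * a)" by (simp add: powr_minus_divide)
        moreover have "\<delta> powr (-1 - 6 * (2 * a)) = Y powr ((24 * a - 1) * (-1 - 12 * a))"
          by (simp add: \<delta>_def powr_powr)
        ultimately show ?thesis by (simp add: powr_add)
      qed
      also have "\<dots> \<le> Y powr (1 - 6 * a)"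
      proof (rule powr_mono)
        \<comment> \<open>The linear terms cancel exactly, which is what fixes the exponent 24a in
          \<open>\<delta>\<close>.\<close>
        have "(1 - 6 * a) - (6 * a + (24 * a - 1) * (-1 - 12 * a)) = 288 * a\<^sup>2"
          by (simp add: power2_eq_square algebra_simps)
        then show "6 * a + (24 * a - 1) * (-1 - 12 * a) \<le> 1 - 6 * a"
          using zero_le_power2[of a] by linarith
      qed (rule Y)
      finally have "2 ^ 7 * (2 * C + 7) ^ 6 * (1 / \<sigma> ^ 6 * \<delta> powr (-1 - 6 * (2 * a))) \<le> 2 ^ 7 * (2 * C + 7) ^ 6 * Y powr (1 - 6 * a)"
        using C by (intro mult_left_mono) auto
      then have "2 ^ 7 * (2 * C + 7) ^ 6 / \<sigma> ^ 6 * \<delta> powr (-1 - 6 * (2 * a)) \<le> 2 ^ 7 * (2 * C + 7) ^ 6 * Y powr (1 - 6 * a)"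
        by simp
      then show ?thesis using vb(2) 1 unfolding K1_def distrib_right by linarith
    qed
    define E where "E = exceptional_set (48 * a) Y \<inter> {..Y + Y powr (1 - a)}"
    define m where "m = (c / 2 * Y powr (1/2 - 2 * a))\<^sup>2"
    \<comment> \<open>The shift by \<open>\<kappa>\<close> moves the evaluation from the left end of
      the gap to its interior; translation does not change the integral.\<close>
    have "measure lebesgue E \<le> 2 * Y / m * (LINT u|lborel. (F (u + \<kappa>))\<^sup>2)"
    proof (rule measure_le_integral_log)
      show "E \<in> sets borel" unfolding E_def by (intro sets.Int exceptional_set_borel) simp
      show "E \<subseteq> {Y..2 * Y}" by (auto simp: E_def exceptional_set_def)
      show "integrable lborel (\<lambda>u. (F (u + \<kappa>))\<^sup>2)"
        using lborel_integrable_real_affine[OF vb(1), of 1 \<kappa>] by (simp add: add.commute)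
      show "m > 0" using c Y by (simp add: m_def)
      fix x assume "x \<in> E"
      then have xe: "x \<in> exceptional_set (48 * a) Y" and xw: "x \<le> Y + Y powr (1 - a)" by (auto simp: E_def)
      have xY: "Y \<le> x" using xe by (auto simp: exceptional_set_def)
      have xw': "x \<le> exp (3 * \<nu>) * (1 + \<sigma>)"
        using xw Y unfolding e3 by (simp add: \<sigma>_def powr_diff powr_minus_divide distrib_left)
      define S M where "S = (\<Sum>j\<in>triples \<nu>. triple_coeff \<sigma> \<nu> j * normal_density 0 \<delta> (ln x + \<kappa> - triple_log j))"
        and "M = (\<Sum>j\<in>triples \<nu>. triple_coeff \<sigma> \<nu> j * normal_density 0 \<delta>0 (ln x + \<kappa> - triple_log j))"
      have F: "F (ln x + \<kappa>) = S - M"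
        unfolding F_def smoothed_difference_def S_def M_def by (simp add: right_diff_distrib sum_subtractf)
      have "S \<le> 8 * exp (3 * \<nu>) / \<delta> * exp (- (\<kappa> / \<delta>)\<^sup>2 / 2)"
        unfolding S_def
      proof (rule fine_sum_le[OF pos(2,4)])
        fix j assume "j \<in> triples \<nu>"
        then show "\<kappa> \<le> \<bar>ln x + \<kappa> - triple_log j\<bar>"
          unfolding \<kappa>_def \<nu>_def using a Y by (intro exceptional_set_far[OF _ _ _ xe]) auto
      qed
      also have "\<kappa> / \<delta> = Y powr (24 * a) / 8"
        using Y by (simp add: defs powr_diff[symmetric])
      also have "8 * exp (3 * \<nu>) / \<delta> * exp (- (Y powr (24 * a) / 8)\<^sup>2 / 2) \<le> c / 2 * Y powr (1/2 - 2 * a)"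
        using elim(5) unfolding e3 \<delta>_def .
      finally have S: "S \<le> c / 2 * Y powr (1/2 - 2 * a)" .
      have "8 \<le> exp \<nu> * \<sigma>" "4 \<le> exp \<nu> * \<delta>0"
        using elim(3,4) Y unfolding e1 \<sigma>_def \<delta>0_def by (simp_all add: powr_diff powr_minus_divide)
      then have "c * \<sigma>\<^sup>2 * exp (3 * \<nu> / 2) \<le> M"
        unfolding M_def c_def using xY by (intro coarse_sum_ge pos \<sigma> \<delta>0\<sigma> \<kappa>\<delta>0 xw') (simp_all add: e3)
      moreover have "\<sigma>\<^sup>2 * exp (3 * \<nu> / 2) = Y powr (1/2 - 2 * a)"
        unfolding e32 using Y by (simp add: defs powr_power powr_add[symmetric] algebra_simps)
      ultimately have M: "c * Y powr (1/2 - 2 * a) \<le> M" by (metis mult.assoc)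
      have "c / 2 * Y powr (1/2 - 2 * a) \<le> M - S" using S M by argo
      then have "m \<le> (M - S)\<^sup>2" unfolding m_def using c by (intro power_mono) auto
      then show "m \<le> (F (ln x + \<kappa>))\<^sup>2" unfolding F by (simp add: power2_commute)
    qed (use Y in auto)
    also have "(LINT u|lborel. (F (u + \<kappa>))\<^sup>2) = (LINT u|lborel. (F u)\<^sup>2)"
      using lborel_integral_real_affine[of 1 "\<lambda>u. (F u)\<^sup>2" \<kappa>] by (simp add: add.commute)
    also have "2 * Y / m * (LINT u|lborel. (F u)\<^sup>2) \<le> 2 * Y / m * (K1 * Y powr (1 - 6 * a))"
      using V Y by (intro mult_left_mono) (auto simp: m_def)
    also have "\<dots> = 8 / c\<^sup>2 * K1 * Y powr (1 - 2 * a)"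
    proof -
      have m: "m = c\<^sup>2 / 4 * Y powr (1 - 4 * a)"
        unfolding m_def power_mult_distrib using Y by (simp add: power_divide powr_power)
      have "Y * Y powr (1 - 6 * a) = Y powr (1 - 2 * a) * Y powr (1 - 4 * a)"
        using Y powr_add[of Y 1 "1 - 6 * a"] by (simp add: powr_add[symmetric])
      then show ?thesis unfolding m using c Y by (simp add: field_simps)
    qed
    finally show ?case unfolding E_def .
  qed
  moreover have "8 / c\<^sup>2 * K1 \<ge> 0" using K1 c by simp
  ultimately show ?thesis by blast
qed

section \<open>From windows to the whole interval [X, 2X]\<close>

lemma exceptional_set_antimono:
  assumes "e \<le> \<epsilon>" "X \<ge> 1"
  shows "exceptional_set \<epsilon> X \<subseteq> exceptional_set e X"
proof
  fix x assume x: "x \<in> exceptional_set \<epsilon> X"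
  then have "x \<ge> 1" using assms by (auto simp: exceptional_set_def)
  then have "x powr e \<le> x powr \<epsilon>" using assms by (intro powr_mono) auto
  then have "{x .. x + x powr e} \<subseteq> {x .. x + x powr \<epsilon>}" by auto
  then show "x \<in> exceptional_set e X" using x unfolding exceptional_set_def by blast
qed

text \<open>The starting points are spaced by the fixed step X^(1 - a), and the window at
  \<open>y k \<ge> X\<close> is at least that long. Being exceptional depends on x alone, and x
  \<le> 2X \<le> 2 y k, so x stays exceptional relative to its own window.\<close>

lemma exceptional_set_windows:
  assumes a: "0 < a" "a < 1" and X: "X \<ge> 1"
  defines "y \<equiv> \<lambda>k::nat. X + real k * X powr (1 - a)"
  shows "exceptional_set e X \<subseteq> (\<Union>k\<le>nat \<lfloor>X powr a\<rfloor>. exceptional_set e (y k) \<inter> {..y k + y k powr (1 - a)})"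
proof
  fix x assume x: "x \<in> exceptional_set e X"
  then have xX: "X \<le> x" "x \<le> 2 * X" by (auto simp: exceptional_set_def)
  define w where "w = X powr (1 - a)"
  have w: "w > 0" using X by (simp add: w_def)
  have wa: "X / w = X powr a" using X by (simp add: w_def powr_diff)
  define k where "k = nat \<lfloor>(x - X) / w\<rfloor>"
  have q0: "0 \<le> (x - X) / w" using xX w by simp
  have k: "real k \<le> (x - X) / w" "(x - X) / w < real k + 1"
    unfolding k_def using q0 by linarith+
  have "(x - X) / w \<le> X / w" using xX w by (intro divide_right_mono) auto
  then have kn: "k \<le> nat \<lfloor>X powr a\<rfloor>" unfolding k_def wa by (intro nat_mono floor_mono)
  have y: "y k \<le> x" "x \<le> y k + w" "X \<le> y k"
    using k w by (auto simp: y_def w_def[symmetric] field_simps)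
  have "w \<le> y k powr (1 - a)" unfolding w_def using y X a by (intro powr_mono2) auto
  then have "x \<in> exceptional_set e (y k) \<inter> {..y k + y k powr (1 - a)}"
    using x y xX by (auto simp: exceptional_set_def)
  then show "x \<in> (\<Union>k\<le>nat \<lfloor>X powr a\<rfloor>. exceptional_set e (y k) \<inter> {..y k + y k powr (1 - a)})"
    using kn by blast
qed

theorem theorem4:
  fixes \<epsilon> :: real
  assumes "lindelof_hypothesis"
    and "\<epsilon> > 0"
  shows "(\<lambda>X::real. measure lebesgue (exceptional_set \<epsilon> X)) \<in> o[at_top](\<lambda>X. X)"
proof -
  \<comment> \<open>Shortening the intervals can only enlarge the exceptional set, so the exponent
    may be capped; the cap 1/2 corresponds to a \<le> 1/96.\<close>
  define e where "e = min \<epsilon> (1/2)"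
  define a where "a = e / 48"
  have a: "0 < a" "a \<le> 1/96" "a < 1" and e: "e = 48 * a" "e \<le> \<epsilon>" using assms(2) by (auto simp: a_def e_def)
  obtain K Y0 where K: "K \<ge> 0" and win: "\<And>Y. Y \<ge> Y0 \<Longrightarrow>
      measure lebesgue (exceptional_set e Y \<inter> {..Y + Y powr (1 - a)}) \<le> K * Y powr (1 - 2 * a)"
    using window_measure_bound[OF assms(1) a(1,2)] unfolding eventually_at_top_linorder e by blast
  \<comment> \<open>At most 2 X^a windows occur, each contributing at most 2 K X^(1 - 2a).\<close>
  have "measure lebesgue (exceptional_set \<epsilon> X) \<le> 4 * K * X powr (1 - a)" if X: "X \<ge> max 1 Y0" for X
  proof -
    define y where "y k = X + real k * X powr (1 - a)" for k :: nat
    define n where "n = nat \<lfloor>X powr a\<rfloor>"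
    let ?E = "\<lambda>k. exceptional_set e (y k) \<inter> {..y k + y k powr (1 - a)}"
    have X1: "X \<ge> 1" using X by simp
    have n: "real n \<le> X powr a" unfolding n_def by simp
    have Ef: "?E k \<in> lmeasurable" for k
      by (intro fmeasurable_Int_fmeasurable exceptional_set_lmeasurable) simp
    have Ek: "measure lebesgue (?E k) \<le> K * (2 * X powr (1 - 2 * a))" if k: "k \<in> {..n}" for k
    proof -
      have "real k * X powr (1 - a) \<le> X powr a * X powr (1 - a)" using k n by (intro mult_right_mono) auto
      also have "\<dots> = X" using X1 by (simp add: powr_add[symmetric])
      finally have y: "X \<le> y k" "y k \<le> 2 * X" by (auto simp: y_def)
      have "y k powr (1 - 2 * a) \<le> (2 * X) powr (1 - 2 * a)" using y X1 a by (intro powr_mono2) auto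
      also have "\<dots> = 2 powr (1 - 2 * a) * X powr (1 - 2 * a)" by (simp add: powr_mult)
      also have "\<dots> \<le> 2 * X powr (1 - 2 * a)"
        using powr_mono[of "1 - 2 * a" 1 "2::real"] a by (intro mult_right_mono) auto
      finally have "K * y k powr (1 - 2 * a) \<le> K * (2 * X powr (1 - 2 * a))" using K by (intro mult_left_mono)
      moreover have "measure lebesgue (?E k) \<le> K * y k powr (1 - 2 * a)" using y X by (intro win) auto
      ultimately show ?thesis by linarith
    qed
    have "exceptional_set \<epsilon> X \<subseteq> (\<Union>k\<le>n. ?E k)"
      using exceptional_set_antimono[OF e(2) X1] exceptional_set_windows[OF a(1,3) X1, of e]
      unfolding y_def n_def by blast
    then have "measure lebesgue (exceptional_set \<epsilon> X) \<le> measure lebesgue (\<Union>k\<le>n. ?E k)"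
      by (intro measure_mono_fmeasurable fmeasurable.finite_UN Ef fmeasurableD[OF exceptional_set_lmeasurable]) auto
    also have "\<dots> \<le> (\<Sum>k\<le>n. measure lebesgue (?E k))"
      by (intro measure_UNION_le fmeasurableD[OF Ef]) auto
    also have "\<dots> \<le> (\<Sum>k\<le>n. K * (2 * X powr (1 - 2 * a)))" by (intro sum_mono Ek)
    also have "\<dots> = (real n + 1) * (K * (2 * X powr (1 - 2 * a)))" by simp
    also have "\<dots> \<le> (2 * X powr a) * (K * (2 * X powr (1 - 2 * a)))"
    proof (rule mult_right_mono)
      have "1 \<le> X powr a" using X1 a by (intro ge_one_powr_ge_zero) auto
      then show "real n + 1 \<le> 2 * X powr a" using n by linarith
    qed (use K in auto)
    also have "\<dots> = 4 * K * (X powr a * X powr (1 - 2 * a))" by simp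
    also have "X powr a * X powr (1 - 2 * a) = X powr (1 - a)" using X1 by (simp add: powr_add[symmetric])
    finally show ?thesis .
  qed
  then have "(\<lambda>X. measure lebesgue (exceptional_set \<epsilon> X)) \<in> O[at_top](\<lambda>X. X powr (1 - a))"
    by (intro bigoI[where c = "4 * K"] eventually_at_top_linorderI[of "max 1 Y0"]) simp
  also have "(\<lambda>X::real. X powr (1 - a)) \<in> o[at_top](\<lambda>X. X)"
    using a by real_asymp
  finally show ?thesis .
qed

end
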